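(* For every integer $k\ge 1$ there exists a $4$-connected MBICP-graph $G_k$ with $n(G_k)=24k+4$ vertices and $e(G_k)=\frac{13\,n(G_k)}{6}-\frac{14}{3}$ edges.
   Context: All graphs are finite and simple; $n(G)$ and $e(G)$ denote numbers of vertices and edges. A drawing maps vertices to distinct points of the plane and edges to arcs joining their end-points; all drawings are good: no edge crosses itself, two edges cross at most once, and two edges with a common end-vertex do not cross. A 1-plane graph is a graph together with a drawing in which every edge is crossed at most once. If edges $ac$ and $bd$ cross at $\alpha$, the end-vertices of the crossing are $N(\alpha)=\{a,b,c,d\}$. An IC-plane graph is a 1-plane graph in which any two distinct crossings have disjoint sets of end-vertices. A bipartite IC-plane graph is a bipartite graph with such a drawing; it is maximal (an MBICP-graph) if no edge can be added to the drawing (keeping the drawing of the existing graph) so that the resulting graph is still a simple bipartite IC-plane graph. *)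

theory Defs
  imports "HOL-Analysis.Analysis"
begin

record 'a ugraph =
  verts :: "'a set"
  edges :: "'a set set"

definition simple_graph :: "'a ugraph \<Rightarrow> bool" where
  "simple_graph G \<longleftrightarrow> finite (verts G) \<and> (\<forall>e\<in>edges G. e \<subseteq> verts G \<and> card e = 2)"

definition bipartite_graph :: "'a ugraph \<Rightarrow> bool" where
  "bipartite_graph G \<longleftrightarrow> simple_graph G \<and>
     (\<exists>A B. A \<union> B = verts G \<and> A \<inter> B = {} \<and> (\<forall>e\<in>edges G. \<exists>a\<in>A. \<exists>b\<in>B. e = {a, b}))"

definition delete_verts :: "'a set \<Rightarrow> 'a ugraph \<Rightarrow> 'a ugraph" where
  "delete_verts S G = \<lparr>verts = verts G - S, edges = {e \<in> edges G. e \<inter> S = {}}\<rparr>"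

definition connected_graph :: "'a ugraph \<Rightarrow> bool" where
  "connected_graph G \<longleftrightarrow> verts G \<noteq> {} \<and>
     (\<forall>u\<in>verts G. \<forall>v\<in>verts G. (\<lambda>x y. {x, y} \<in> edges G)\<^sup>*\<^sup>* u v)"

definition k_connected_graph :: "nat \<Rightarrow> 'a ugraph \<Rightarrow> bool" where
  "k_connected_graph k G \<longleftrightarrow> simple_graph G \<and> card (verts G) > k \<and>
     (\<forall>S\<subseteq>verts G. card S < k \<longrightarrow> connected_graph (delete_verts S G))"

text \<open>The plane is the type of complex numbers. Only the values of \<open>pos\<close> on vertices
  and of \<open>curve\<close> on edges are relevant.\<close>

record 'a drawing =
  pos :: "'a \<Rightarrow> complex"
  curve :: "'a set \<Rightarrow> real \<Rightarrow> complex"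

text \<open>Two curves cross at a point if some homeomorphism of a neighbourhood of it onto the
  unit disc takes them to two perpendicular diameters. This excludes touching points, and
  it forces the point to be interior to both curves.\<close>

definition curves_cross_at :: "(real \<Rightarrow> complex) \<Rightarrow> (real \<Rightarrow> complex) \<Rightarrow> complex \<Rightarrow> bool" where
  "curves_cross_at g h z \<longleftrightarrow>
     (\<exists>U \<phi> \<psi>. open U \<and> z \<in> U \<and> homeomorphism U (ball 0 1) \<phi> \<psi> \<and> \<phi> z = 0 \<and>
        \<phi> ` (path_image g \<inter> U) = {w \<in> ball 0 1. Im w = 0} \<and>
        \<phi> ` (path_image h \<inter> U) = {w \<in> ball 0 1. Re w = 0})"

definition edges_cross_at ::
  "'a ugraph \<Rightarrow> 'a drawing \<Rightarrow> 'a set \<Rightarrow> 'a set \<Rightarrow> complex \<Rightarrow> bool" where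
  "edges_cross_at G D e f z \<longleftrightarrow>
     e \<in> edges G \<and> f \<in> edges G \<and> e \<noteq> f \<and> curves_cross_at (curve D e) (curve D f) z"

text \<open>The usual conventions for drawings are made explicit: an edge contains no vertex other
  than its ends, and two edges meet only in common ends and in crossings.\<close>

definition is_drawing :: "'a ugraph \<Rightarrow> 'a drawing \<Rightarrow> bool" where
  "is_drawing G D \<longleftrightarrow>
     inj_on (pos D) (verts G) \<and>
     (\<forall>e\<in>edges G. arc (curve D e) \<and>
        {pathstart (curve D e), pathfinish (curve D e)} = pos D ` e \<and>
        path_image (curve D e) \<inter> pos D ` verts G = pos D ` e) \<and>
     (\<forall>e\<in>edges G. \<forall>f\<in>edges G. e \<noteq> f \<longrightarrow>
        (\<forall>z \<in> path_image (curve D e) \<inter> path_image (curve D f).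
           z \<in> pos D ` (e \<inter> f) \<or> edges_cross_at G D e f z))"

text \<open>That no edge crosses itself is already part of \<open>arc\<close>.\<close>

definition good_drawing :: "'a ugraph \<Rightarrow> 'a drawing \<Rightarrow> bool" where
  "good_drawing G D \<longleftrightarrow> is_drawing G D \<and>
     (\<forall>e f z z'. edges_cross_at G D e f z \<and> edges_cross_at G D e f z' \<longrightarrow> z = z') \<and>
     (\<forall>e f z. edges_cross_at G D e f z \<longrightarrow> e \<inter> f = {})"

definition one_plane_graph :: "'a ugraph \<Rightarrow> 'a drawing \<Rightarrow> bool" where
  "one_plane_graph G D \<longleftrightarrow> simple_graph G \<and> good_drawing G D \<and>
     (\<forall>e f f' z z'. edges_cross_at G D e f z \<and> edges_cross_at G D e f' z' \<longrightarrow>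
        f = f' \<and> z = z')"

definition crossings :: "'a ugraph \<Rightarrow> 'a drawing \<Rightarrow> complex set" where
  "crossings G D = {z. \<exists>e f. edges_cross_at G D e f z}"

definition crossing_ends :: "'a ugraph \<Rightarrow> 'a drawing \<Rightarrow> complex \<Rightarrow> 'a set" where
  "crossing_ends G D z = \<Union>{e. \<exists>f. edges_cross_at G D e f z}"

definition IC_plane_graph :: "'a ugraph \<Rightarrow> 'a drawing \<Rightarrow> bool" where
  "IC_plane_graph G D \<longleftrightarrow> one_plane_graph G D \<and>
     (\<forall>\<alpha>\<in>crossings G D. \<forall>\<beta>\<in>crossings G D.
        \<alpha> \<noteq> \<beta> \<longrightarrow> crossing_ends G D \<alpha> \<inter> crossing_ends G D \<beta> = {})"

definition bipartite_IC_plane_graph :: "'a ugraph \<Rightarrow> 'a drawing \<Rightarrow> bool" where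
  "bipartite_IC_plane_graph G D \<longleftrightarrow> bipartite_graph G \<and> IC_plane_graph G D"

definition add_edge :: "'a set \<Rightarrow> 'a ugraph \<Rightarrow> 'a ugraph" where
  "add_edge e G = \<lparr>verts = verts G, edges = insert e (edges G)\<rparr>"

definition draw_edge :: "'a set \<Rightarrow> (real \<Rightarrow> complex) \<Rightarrow> 'a drawing \<Rightarrow> 'a drawing" where
  "draw_edge e c D = \<lparr>pos = pos D, curve = (curve D)(e := c)\<rparr>"

definition MBICP_graph :: "'a ugraph \<Rightarrow> 'a drawing \<Rightarrow> bool" where
  "MBICP_graph G D \<longleftrightarrow> bipartite_IC_plane_graph G D \<and>
     \<not> (\<exists>e c. e \<notin> edges G \<and> bipartite_IC_plane_graph (add_edge e G) (draw_edge e c D))"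

end

theory Submission imports Defs
begin

text \<open>The graph is drawn with straight segments around the origin. Concentric squares
  \<open>S\<^sub>0, \<dots>, S\<^sub>k\<close> carry four vertices each, and the space between consecutive squares
  is filled with 20 further vertices; multiplication by \<open>\<i>\<close> is a symmetry, and multiplication by 6
  takes each layer to the next one. In every layer there are four crossings, whose 16 end-vertices
  are all distinct. Removing one edge from every crossing leaves a quadrangulation, so any two
  vertices of different colours on a common face are adjacent, and no new edge can be drawn without
  a crossing. A new edge that crosses an old one needs an edge whose ends both lie outside the old
  crossings, and only the sides of the squares \<open>S\<^sub>t\<close> are such edges. The vertices outside
  the crossings on the two faces at such a side all lie on the same square: for the inner face of
  \<open>S\<^sub>0\<close> and the outer face of \<open>S\<^sub>k\<close> these are its other two vertices, and for all
  other faces the ends of the side themselves. The new edge would therefore be an old one.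

  For 4-connectivity, two consecutive squares bound a block of 28 vertices, and consecutive blocks
  share four vertices. It thus suffices that one block is 4-connected, which is certified by explicit
  systems of four disjoint paths.\<close>

text \<open>The new edge in the maximality proof is an arbitrary arc, so faces are needed as
  topological objects. They are not obtained as components of the complement: a face is given
  directly as a closed set (a convex polygon, or the inside or outside of a square) whose frontier
  lies in the drawing. These sets cover the plane, and a connected set that avoids the drawing
  cannot leave one that it meets. The coordinates are chosen so that the bounded faces are convex;
  incidences between sites, edges and faces then become linear inequalities over finitely many
  cases. The factor 6 is the ratio between the outer and the inner square of a trapezoid. Taking the
  trapezoid half-open makes layer, quarter turn and point unique coordinates, which reduces
  statements about \<open>k\<close> layers to a single trapezoid. A crossing is defined by a chart.
  \<open>AC\<close> and \<open>BD\<close> are perpendicular and divided by their common point in the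
  same ratio, so an affine map serves as the chart for both. Conversely, it has to be excluded that
  a segment is crossed at one of its ends.\<close>

section \<open>The graph and its drawing\<close>

text \<open>Up to rotation and scaling all vertices and edges lie in a single trapezoid with the corners
  \<open>I0, I1, O0, O1\<close>; the segments \<open>AC\<close> and \<open>BD\<close> cross at the point 3. The sites \<open>Cp\<close> and
  \<open>Dp\<close> are the sites \<open>C\<close> and \<open>D\<close> of the trapezoid that precedes it in the rotation.\<close>

datatype site = I0 | I1 | M0 | M1 | B | C | A | D | O0 | O1 | Cp | Dp

primrec site_point :: "site \<Rightarrow> complex" where
  "site_point I0 = Complex 1 (-1)"
| "site_point I1 = Complex 1 1"
| "site_point M0 = Complex 3 (-3)"
| "site_point M1 = Complex 3 3"
| "site_point B = Complex 2 (-1)"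
| "site_point C = Complex 2 1"
| "site_point A = Complex 5 (-2)"
| "site_point D = Complex 5 2"
| "site_point O0 = Complex 6 (-6)"
| "site_point O1 = Complex 6 6"
| "site_point Cp = Complex 1 (-2)"
| "site_point Dp = Complex 2 (-5)"

text \<open>The numbers of \<open>A\<close> and \<open>B\<close> are shifted by one so that the colour of a vertex is its
  parity.\<close>

primrec label :: "nat \<Rightarrow> nat \<Rightarrow> site \<Rightarrow> nat" where
  "label t j I0 = 24 * t + j"
| "label t j I1 = 24 * t + (j + 1) mod 4"
| "label t j M0 = 24 * t + 4 + j"
| "label t j M1 = 24 * t + 4 + (j + 1) mod 4"
| "label t j B = 24 * t + 8 + (j + 1) mod 4"
| "label t j C = 24 * t + 12 + j"
| "label t j A = 24 * t + 16 + (j + 1) mod 4"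
| "label t j D = 24 * t + 20 + j"
| "label t j O0 = 24 * t + 24 + j"
| "label t j O1 = 24 * t + 24 + (j + 1) mod 4"
| "label t j Cp = 24 * t + 12 + (j + 3) mod 4"
| "label t j Dp = 24 * t + 20 + (j + 3) mod 4"

definition site_edges :: "(site \<times> site) set" where
  "site_edges = {(I0,I1), (I0,B), (B,C), (C,I1), (M0,B), (C,M1), (M0,A), (A,D), (D,M1),
     (A,C), (B,D), (A,O0), (D,O1)}"

text \<open>The layers are numbered from 0 to \<open>k - 1\<close>; the layer \<open>k\<close> consists of the outermost
  square only.\<close>

definition edge_index :: "nat \<Rightarrow> (nat \<times> nat \<times> site \<times> site) set" where
  "edge_index k = {(t, j, p, q). j < 4 \<and> (p, q) \<in> site_edges \<and> (t < k \<or> t = k \<and> p = I0 \<and> q = I1)}"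

definition edge_at :: "nat \<times> nat \<times> site \<times> site \<Rightarrow> nat set" where
  "edge_at = (\<lambda>(t, j, p, q). {label t j p, label t j q})"

definition chain_graph :: "nat \<Rightarrow> nat ugraph" where
  "chain_graph k = \<lparr>verts = {..<24 * k + 4}, edges = edge_at ` edge_index k\<rparr>"

definition cell_map :: "nat \<Rightarrow> nat \<Rightarrow> complex \<Rightarrow> complex" where
  "cell_map t j w = 6 ^ t * \<i> ^ j * w"

text \<open>The listed points are those of the vertices 0, 4, 8, 12, 16 and 20. Because of the shift
  in the numbering, the entries for \<open>B\<close> and \<open>A\<close> are their site points
  turned clockwise by a right angle.\<close>

definition shape :: "nat \<Rightarrow> complex" where
  "shape m = \<i> ^ (m mod 4) * [Complex 1 (-1), Complex 3 (-3), Complex (-1) (-2), Complex 2 1,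
     Complex (-2) (-5), Complex 5 2] ! (m div 4)"

definition vertex_point :: "nat \<Rightarrow> complex" where
  "vertex_point n = 6 ^ (n div 24) * shape (n mod 24)"

text \<open>An edge is a set, so \<open>Min\<close> and \<open>Max\<close> merely choose a direction
  for its segment.\<close>

definition chain_drawing :: "nat drawing" where
  "chain_drawing = \<lparr>pos = vertex_point,
     curve = (\<lambda>e. linepath (vertex_point (Min e)) (vertex_point (Max e)))\<rparr>"

text \<open>Half-open, so that the images under \<open>cell_map t j\<close> with
  \<open>j < 4\<close> partition the points of maximum norm at least 1;
  \<open>cell_map_unique\<close> and \<open>cell_map_cover\<close> establish this.\<close>

definition cell :: "complex set" where
  "cell = {w. 1 \<le> Re w \<and> Re w < 6 \<and> - Re w \<le> Im w \<and> Im w < Re w}"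

lemma less4_cases: "(j::nat) < 4 \<longleftrightarrow> j = 0 \<or> j = 1 \<or> j = 2 \<or> j = 3"
  by auto

lemma i_power: "\<i> ^ 2 = -1" "\<i> ^ 3 = -\<i>" "\<i> ^ 4 = 1"
  by (simp_all add: eval_nat_numeral)

text \<open>A vertex can be a site of several trapezoids; this checks that all its names give the
  same point.\<close>

lemma vertex_point_label:
  assumes "j < 4"
  shows "vertex_point (label t j s) = cell_map t j (site_point s)"
proof -
  have 1: "vertex_point (24 * t + m) = 6 ^ t * shape m" if "m < 24" for t m
    using that by (simp add: vertex_point_def)
  have 2: "label t j s = 24 * t + label 0 j s" by (cases s) auto
  \<comment> \<open>\<open>O0\<close> and \<open>O1\<close> are numbered in the next layer, where
    \<open>n div 24\<close> contributes one more factor 6.\<close>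
  have 3: "vertex_point (label 0 j s) = \<i> ^ j * site_point s"
  proof (cases "s = O0 \<or> s = O1")
    case True
    define m where "m = (if s = O0 then j else (j + 1) mod 4)"
    have "m < 24" using assms by (auto simp: m_def)
    then have "vertex_point (24 + m) = 6 * shape m"
      using 1[of m 1] by simp
    moreover have "label 0 j s = 24 + m"
      using True by (auto simp: m_def)
    moreover have "6 * shape m = \<i> ^ j * site_point s"
      using assms True unfolding less4_cases m_def
      by (elim disjE; simp add: shape_def complex_eq_iff i_power)
    ultimately show ?thesis by simp
  next
    case False
    then have "label 0 j s < 24" using assms by (cases s) auto
    then have "vertex_point (label 0 j s) = shape (label 0 j s)"
      using 1[of _ 0] by simp
    also have "\<dots> = \<i> ^ j * site_point s"
      using assms False unfolding less4_cases
      by (cases s; elim disjE; simp add: shape_def complex_eq_iff i_power)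
    finally show ?thesis .
  qed
  have "vertex_point (24 * t + n) = 6 ^ t * vertex_point n" for n
    by (simp add: vertex_point_def power_add)
  with 2 3 show ?thesis by (simp add: cell_map_def)
qed

section \<open>Layer, quarter turn and cell point as coordinates of the plane\<close>

definition sup_norm :: "complex \<Rightarrow> real" where
  "sup_norm z = max \<bar>Re z\<bar> \<bar>Im z\<bar>"

lemma sup_norm_cell_map:
  assumes "j < 4"
  shows "sup_norm (cell_map t j w) = 6 ^ t * sup_norm w"
proof -
  have "sup_norm (\<i> ^ j * w) = sup_norm w"
    using assms unfolding less4_cases by (elim disjE; simp add: sup_norm_def i_power max.commute)
  moreover have "sup_norm (6 ^ t * z) = 6 ^ t * sup_norm z" for z
  proof -
    have "6 ^ t * z = (6 ^ t) *\<^sub>R z" by (simp add: scaleR_conv_of_real)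
    then show ?thesis
      by (simp add: sup_norm_def abs_mult max_mult_distrib_left)
  qed
  ultimately show ?thesis by (simp add: cell_map_def mult.assoc)
qed

lemma sup_norm_cell: "w \<in> cell \<Longrightarrow> sup_norm w = Re w"
  by (auto simp: cell_def sup_norm_def)

lemma cell_map_inj: "cell_map t j w = cell_map t j w' \<longleftrightarrow> w = w'"
  by (simp add: cell_map_def)

text \<open>The exponent is the integer part of the logarithm to base 6.\<close>

lemma power_six_unique:
  fixes x y :: real
  assumes "6 ^ t * x = 6 ^ t' * y" "1 \<le> x" "x < 6" "1 \<le> y" "y < 6"
  shows "t = t'"
proof -
  have *: "t' \<le> t" if "6 ^ t * x = 6 ^ t' * y" "1 \<le> x" "x < 6" "1 \<le> y" "y < 6"
    for t t' and x y :: real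
  proof (rule ccontr)
    assume "\<not> t' \<le> t"
    then have "(6::real) ^ Suc t \<le> 6 ^ t'" by (intro power_increasing) auto
    then have "6 ^ Suc t * 1 \<le> 6 ^ t' * y" using that by (intro mult_mono) auto
    moreover have "6 ^ t * x < 6 ^ t * 6" by (rule mult_strict_left_mono) (use that in auto)
    ultimately show False using that by simp
  qed
  show ?thesis using *[of t x t' y] *[of t' y t x] assms by simp
qed

lemma rotated_cell_disjoint:
  assumes "w \<in> cell" "\<i> ^ d * w \<in> cell" "d < 4"
  shows "d = 0"
proof -
  have "1 \<le> Re w" "- Re w \<le> Im w" "Im w < Re w" "\<i> * w \<notin> cell" "- w \<notin> cell" "- (\<i> * w) \<notin> cell"
    using assms(1) by (auto simp: cell_def)
  then show ?thesis using assms(2,3) unfolding less4_cases by (auto simp: i_power)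
qed

text \<open>Quarter turns preserve the maximum norm, which lies between 1 and 6 on
  \<open>cell\<close> and so determines \<open>t\<close>. The four turned copies of
  \<open>cell\<close> are disjoint, which determines \<open>j\<close>.\<close>

lemma cell_map_unique:
  assumes "cell_map t j w = cell_map t' j' w'" "w \<in> cell" "w' \<in> cell" "j < 4" "j' < 4"
  shows "t = t'" "j = j'" "w = w'"
proof -
  have "6 ^ t * Re w = 6 ^ t' * Re w'"
    using assms sup_norm_cell_map sup_norm_cell by metis
  then show t: "t = t'"
    by (rule power_six_unique) (use assms in \<open>auto simp: cell_def\<close>)
  have eq: "\<i> ^ j * w = \<i> ^ j' * w'"
    using assms(1) t by (simp add: cell_map_def mult.assoc)
  have *: "a = b" if "a \<le> b" "b < 4" "\<i> ^ a * u = \<i> ^ b * v" "u \<in> cell" "v \<in> cell" for a b u v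
  proof -
    have "\<i> ^ b = \<i> ^ a * \<i> ^ (b - a)" using that(1) by (simp flip: power_add)
    then have "u = \<i> ^ (b - a) * v" using that(3) by simp
    then have "\<i> ^ (b - a) * v \<in> cell" using that(4) by simp
    then have "b - a = 0" using rotated_cell_disjoint that(2,5) by (meson less_imp_diff_less)
    then show ?thesis using that(1) by simp
  qed
  show "j = j'"
    using *[of j j' w w'] *[of j' j w' w] eq assms(2-) by (metis nat_le_linear)
  then show "w = w'" using eq by simp
qed

lemma cell_map_cover:
  assumes "1 \<le> sup_norm z"
  obtains t j w where "j < 4" "w \<in> cell" "z = cell_map t j w"
proof -
  obtain u where u: "sup_norm z < 6 ^ u" using real_arch_pow[of 6 "sup_norm z"] by auto
  define t where "t = (LEAST u. sup_norm z < 6 ^ Suc u)"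
  have "(6::real) ^ u \<le> 6 ^ Suc u" by (rule power_increasing) auto
  with u have "sup_norm z < 6 ^ Suc u" by linarith
  then have up: "sup_norm z < 6 ^ Suc t" unfolding t_def by (rule LeastI)
  have lo: "6 ^ t \<le> sup_norm z"
  proof (cases t)
    case (Suc n)
    then have "\<not> sup_norm z < 6 ^ Suc n" using not_less_Least[of n "\<lambda>u. sup_norm z < 6 ^ Suc u"]
      by (simp add: t_def)
    then show ?thesis using Suc by simp
  qed (use assms in simp)
  define v where "v = z / 6 ^ t"
  have z: "z = cell_map t 0 v" by (simp add: v_def cell_map_def)
  have v: "1 \<le> sup_norm v" "sup_norm v < 6"
    using lo up unfolding z by (simp_all add: sup_norm_cell_map)
  consider "v \<in> cell" | "- \<i> * v \<in> cell" | "- v \<in> cell" | "\<i> * v \<in> cell"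
    using v by (simp add: cell_def sup_norm_def) linarith
  then show ?thesis
  proof cases
    case 1 then show ?thesis using that[of 0 v t] z by simp
  next
    case 2 then show ?thesis using that[of 1 "- \<i> * v" t] z by (simp add: cell_map_def complex_eq_iff)
  next
    case 3 then show ?thesis using that[of 2 "- v" t] z by (simp add: cell_map_def)
  next
    case 4 then show ?thesis using that[of 3 "\<i> * v" t] z by (simp add: cell_map_def i_power complex_eq_iff)
  qed
qed

section \<open>Edges within a cell\<close>

lemma in_open_segment_complex:
  "z \<in> open_segment p q \<longleftrightarrow> p \<noteq> q \<and>
     (\<exists>u. 0 < u \<and> u < 1 \<and> Re z = Re p - u * Re p + u * Re q \<and> Im z = Im p - u * Im p + u * Im q)"
  by (auto simp: in_segment complex_eq_iff left_diff_distrib)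

text \<open>Only the open segments fit: \<open>I1\<close>, \<open>M1\<close>, \<open>O0\<close> and
  \<open>O1\<close> lie outside the half-open \<open>cell\<close>.\<close>

lemma open_site_edge_in_cell:
  assumes "(p, q) \<in> site_edges" "w \<in> open_segment (site_point p) (site_point q)"
  shows "w \<in> cell"
proof -
  \<comment> \<open>With the end-points inserted everything is linear in \<open>u\<close>,
    \<open>x\<close> and \<open>y\<close>, which leaves one linear problem per edge. The next lemmas
    proceed in the same way.\<close>
  have *: "\<forall>(p, q) \<in> site_edges. \<forall>u x y. 0 < u \<longrightarrow> u < 1 \<longrightarrow>
      x = Re (site_point p) - u * Re (site_point p) + u * Re (site_point q) \<longrightarrow>
      y = Im (site_point p) - u * Im (site_point p) + u * Im (site_point q) \<longrightarrow>
      1 \<le> x \<and> x < 6 \<and> - x \<le> y \<and> y < x"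
    unfolding site_edges_def ball_simps case_prod_conv site_point.simps complex.sel mult_1_right mult_minus1_right
    by (intro conjI allI impI; (rule TrueI | linarith))
  obtain u where "0 < u" "u < 1"
    "Re w = Re (site_point p) - u * Re (site_point p) + u * Re (site_point q)"
    "Im w = Im (site_point p) - u * Im (site_point p) + u * Im (site_point q)"
    using assms(2) unfolding in_open_segment_complex by blast
  from *[THEN bspec, OF assms(1), unfolded case_prod_conv, rule_format, OF this]
  show ?thesis unfolding cell_def by simp
qed

lemma open_site_edges_meet:
  assumes "(p, q) \<in> site_edges" "(p', q') \<in> site_edges"
    "w \<in> open_segment (site_point p) (site_point q)"
    "w \<in> open_segment (site_point p') (site_point q')"
  shows "p = p' \<and> q = q' \<or>
    (p = A \<and> q = C \<and> p' = B \<and> q' = D \<or> p = B \<and> q = D \<and> p' = A \<and> q' = C) \<and> w = 3"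
proof -
  have *: "\<forall>(p, q) \<in> site_edges. \<forall>(p', q') \<in> site_edges. \<forall>u v x y.
      0 < u \<longrightarrow> u < 1 \<longrightarrow> 0 < v \<longrightarrow> v < 1 \<longrightarrow>
      x = Re (site_point p) - u * Re (site_point p) + u * Re (site_point q) \<longrightarrow>
      y = Im (site_point p) - u * Im (site_point p) + u * Im (site_point q) \<longrightarrow>
      x = Re (site_point p') - v * Re (site_point p') + v * Re (site_point q') \<longrightarrow>
      y = Im (site_point p') - v * Im (site_point p') + v * Im (site_point q') \<longrightarrow>
      p = p' \<and> q = q' \<or>
      (p = A \<and> q = C \<and> p' = B \<and> q' = D \<or> p = B \<and> q = D \<and> p' = A \<and> q' = C) \<and> x = 3 \<and> y = 0"
    unfolding site_edges_def ball_simps case_prod_conv site_point.simps complex.sel mult_1_right mult_minus1_right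
      mult_1_right mult_minus1_right site.distinct simp_thms
    by (intro conjI allI impI; (rule TrueI | linarith))
  obtain u where "0 < u" "u < 1" "Re w = Re (site_point p) - u * Re (site_point p) + u * Re (site_point q)"
      "Im w = Im (site_point p) - u * Im (site_point p) + u * Im (site_point q)"
    using assms(3) unfolding in_open_segment_complex by blast
  moreover obtain v where "0 < v" "v < 1" "Re w = Re (site_point p') - v * Re (site_point p') + v * Re (site_point q')"
      "Im w = Im (site_point p') - v * Im (site_point p') + v * Im (site_point q')"
    using assms(4) unfolding in_open_segment_complex by blast
  moreover note *[THEN bspec, OF assms(1), unfolded case_prod_conv, THEN bspec, OF assms(2),
      unfolded case_prod_conv, rule_format, of u v "Re w" "Im w"]
  moreover have "w = 3 \<longleftrightarrow> Re w = 3 \<and> Im w = 0" by (simp add: complex_eq_iff)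
  ultimately show ?thesis by blast
qed

text \<open>The sites inside \<open>cell\<close>: every vertex has exactly one name
  \<open>label t j s\<close> with \<open>j < 4\<close> and \<open>s\<close> in this set, by
  \<open>vertex_label\<close> and \<open>label_inj\<close>.\<close>

definition vertex_sites :: "site set" where
  "vertex_sites = {I0, M0, B, C, A, D}"

lemma vertex_site_in_cell: "s \<in> vertex_sites \<Longrightarrow> site_point s \<in> cell"
  by (auto simp: vertex_sites_def cell_def)

lemma site_not_in_open_edge:
  assumes "s \<in> vertex_sites" "(p, q) \<in> site_edges"
  shows "site_point s \<notin> open_segment (site_point p) (site_point q)"
proof -
  have "\<forall>(p, q) \<in> site_edges. \<forall>s \<in> vertex_sites. \<forall>u. 0 < u \<longrightarrow> u < 1 \<longrightarrow>
      Re (site_point s) = Re (site_point p) - u * Re (site_point p) + u * Re (site_point q) \<longrightarrow>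
      Im (site_point s) = Im (site_point p) - u * Im (site_point p) + u * Im (site_point q) \<longrightarrow> False"
    unfolding site_edges_def vertex_sites_def ball_simps case_prod_conv site_point.simps complex.sel mult_1_right mult_minus1_right
    by (intro conjI allI impI; (rule TrueI | linarith))
  note no = this[THEN bspec, OF assms(2), unfolded case_prod_conv, THEN bspec, OF assms(1), rule_format]
  show ?thesis
  proof
    assume "site_point s \<in> open_segment (site_point p) (site_point q)"
    then obtain u where u: "0 < u" "u < 1"
      "Re (site_point s) = Re (site_point p) - u * Re (site_point p) + u * Re (site_point q)"
      "Im (site_point s) = Im (site_point p) - u * Im (site_point p) + u * Im (site_point q)"
      unfolding in_open_segment_complex by blast
    show False by (rule no[OF u])
  qed
qed

lemma site_point_inj_on: "inj_on site_point vertex_sites"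
  by (auto simp: inj_on_def vertex_sites_def)

lemma vertex_label:
  obtains t j s where "j < 4" "s \<in> vertex_sites" "n = label t j s"
proof -
  define t r j where "t = n div 24" and "r = n mod 24 div 4" and "j = n mod 4"
  have "n mod 24 mod 4 = j" by (simp add: j_def mod_mod_cancel)
  then have "n mod 24 = 4 * r + j" unfolding r_def by (metis mult_div_mod_eq)
  then have n: "n = 24 * t + (4 * r + j)" unfolding t_def by (metis mult_div_mod_eq)
  have j: "j < 4" by (simp add: j_def)
  have r: "r < 6" by (simp add: r_def less_mult_imp_div_less)
  \<comment> \<open>The numbers of \<open>B\<close> and \<open>A\<close> are shifted by one, so
    these vertices belong to the preceding trapezoid \<open>(j + 3) mod 4\<close>.\<close>
  have mod: "((j + 3) mod 4 + 1) mod 4 = j" using j unfolding less4_cases by auto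
  from r consider "r = 0" | "r = 1" | "r = 2" | "r = 3" | "r = 4" | "r = 5" by linarith
  then show ?thesis
  proof cases
    case 1 then show ?thesis using that[of j I0 t] j n by (simp add: vertex_sites_def)
  next
    case 2 then show ?thesis using that[of j M0 t] j n by (simp add: vertex_sites_def)
  next
    case 3 then show ?thesis using that[of "(j + 3) mod 4" B t] mod n by (simp add: vertex_sites_def)
  next
    case 4 then show ?thesis using that[of j C t] j n by (simp add: vertex_sites_def)
  next
    case 5 then show ?thesis using that[of "(j + 3) mod 4" A t] mod n by (simp add: vertex_sites_def)
  next
    case 6 then show ?thesis using that[of j D t] j n by (simp add: vertex_sites_def)
  qed
qed

lemma vertex_point_inj: "inj vertex_point"
proof (rule injI)
  fix m n assume eq: "vertex_point m = vertex_point n"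
  obtain t j s where m: "j < 4" "s \<in> vertex_sites" "m = label t j s" by (rule vertex_label)
  obtain t' j' s' where n: "j' < 4" "s' \<in> vertex_sites" "n = label t' j' s'" by (rule vertex_label)
  have "cell_map t j (site_point s) = cell_map t' j' (site_point s')"
    using eq m n by (simp add: vertex_point_label)
  with m n show "m = n"
    using cell_map_unique[of t j "site_point s" t' j' "site_point s'"] vertex_site_in_cell
      inj_onD[OF site_point_inj_on] by metis
qed

lemma cell_map_segment:
  "cell_map t j ` closed_segment a b = closed_segment (cell_map t j a) (cell_map t j b)"
  "cell_map t j ` open_segment a b = open_segment (cell_map t j a) (cell_map t j b)"
proof -
  have "linear (cell_map t j)"
    by (rule linearI) (simp_all add: cell_map_def distrib_left scaleR_conv_of_real)
  then show "cell_map t j ` closed_segment a b = closed_segment (cell_map t j a) (cell_map t j b)"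
    by (rule closed_segment_linear_image[symmetric])
  show "cell_map t j ` open_segment a b = open_segment (cell_map t j a) (cell_map t j b)"
    by (rule open_segment_linear_image[symmetric])
      (use \<open>linear (cell_map t j)\<close> cell_map_inj in \<open>auto simp: inj_def\<close>)
qed

section \<open>Crossings of straight segments\<close>

text \<open>Turning the chart by a right angle exchanges the two diameters.\<close>

lemma curves_cross_at_sym:
  assumes "curves_cross_at g h z"
  shows "curves_cross_at h g z"
proof -
  obtain U \<phi> \<psi> where *: "open U" "z \<in> U" "homeomorphism U (ball 0 1) \<phi> \<psi>" "\<phi> z = 0"
    "\<phi> ` (path_image g \<inter> U) = {w \<in> ball 0 1. Im w = 0}"
    "\<phi> ` (path_image h \<inter> U) = {w \<in> ball 0 1. Re w = 0}"
    using assms unfolding curves_cross_at_def by blast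
  have rot: "homeomorphism (ball 0 1) (ball 0 1) ((*) \<i>) ((*) (- \<i>))"
    by (rule homeomorphismI) (auto intro!: continuous_intros simp: norm_mult)
  have "homeomorphism U (ball 0 1) ((*) \<i> \<circ> \<phi>) (\<psi> \<circ> (*) (- \<i>))"
    by (rule homeomorphism_compose[OF *(3) rot])
  moreover have "((*) \<i> \<circ> \<phi>) ` (path_image g \<inter> U) = {w \<in> ball 0 1. Re w = 0}"
    unfolding image_comp[symmetric] *(5)
  proof (intro equalityI subsetI)
    fix w :: complex assume "w \<in> {w \<in> ball 0 1. Re w = 0}"
    then show "w \<in> (*) \<i> ` {w \<in> ball 0 1. Im w = 0}"
      by (intro image_eqI[of _ _ "- \<i> * w"]) (auto simp: norm_mult simp flip: mult.assoc)
  qed (auto simp: norm_mult)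
  moreover have "((*) \<i> \<circ> \<phi>) ` (path_image h \<inter> U) = {w \<in> ball 0 1. Im w = 0}"
    unfolding image_comp[symmetric] *(6)
  proof (intro equalityI subsetI)
    fix w :: complex assume "w \<in> {w \<in> ball 0 1. Im w = 0}"
    then show "w \<in> (*) \<i> ` {w \<in> ball 0 1. Re w = 0}"
      by (intro image_eqI[of _ _ "- \<i> * w"]) (auto simp: norm_mult simp flip: mult.assoc)
  qed (auto simp: norm_mult)
  ultimately show ?thesis
    unfolding curves_cross_at_def using *(1,2,4) by (metis comp_apply mult_zero_right)
qed

lemma curves_cross_at_in_path_image:
  assumes "curves_cross_at g h z"
  shows "z \<in> path_image g"
proof -
  obtain U \<phi> \<psi> where *: "z \<in> U" "homeomorphism U (ball 0 1) \<phi> \<psi>" "\<phi> z = 0"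
    "\<phi> ` (path_image g \<inter> U) = {w \<in> ball 0 1. Im w = 0}"
    using assms unfolding curves_cross_at_def by blast
  have "0 \<in> \<phi> ` (path_image g \<inter> U)" unfolding *(4) by simp
  then obtain x where "x \<in> path_image g" "x \<in> U" "\<phi> x = 0" by auto
  then show ?thesis using *(1-3) by (metis homeomorphism_apply1)
qed

text \<open>Near an end of a segment, the segment minus that end is connected, but the diameter of
  the disc minus its centre is not.\<close>

lemma not_curves_cross_at_end:
  assumes g: "path_image g = closed_segment a b"
  shows "\<not> curves_cross_at g h a"
proof
  assume "curves_cross_at g h a"
  then obtain U \<phi> \<psi> where *: "open U" "a \<in> U" "homeomorphism U (ball 0 1) \<phi> \<psi>" "\<phi> a = 0"
    and im: "\<phi> ` (closed_segment a b \<inter> U) = {w \<in> ball 0 1. Im w = 0}"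
    unfolding curves_cross_at_def g by blast
  have \<psi>\<phi>: "\<psi> (\<phi> x) = x" if "x \<in> U" for x
    using *(3) that by (simp add: homeomorphism_def)
  have \<phi>\<psi>: "\<phi> (\<psi> w) = w" if "w \<in> ball 0 1" for w
    using *(3) that by (simp add: homeomorphism_def)
  have \<psi>0: "\<psi> 0 = a" using \<psi>\<phi>[OF *(2)] *(4) by simp
  obtain \<epsilon> where \<epsilon>: "\<epsilon> > 0" "ball a \<epsilon> \<subseteq> U" using *(1,2) open_contains_ball by blast
  have "continuous_on (ball 0 1) \<psi>" using *(3) by (simp add: homeomorphism_def)
  then obtain d where d: "d > 0" "\<And>w. w \<in> ball 0 1 \<Longrightarrow> dist w 0 < d \<Longrightarrow> dist (\<psi> w) (\<psi> 0) < \<epsilon>"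
    using \<epsilon>(1) unfolding continuous_on_iff by (metis centre_in_ball zero_less_one)
  define r where "r = min d 1 / 2"
  have r: "0 < r" "r < d" "r < 1" using d(1) by (auto simp: r_def)
  \<comment> \<open>These points come from opposite halves of the diameter, near enough to its
    centre for the segment between them to stay in \<open>U\<close>.\<close>
  define x y where "x = \<psi> (of_real r)" and "y = \<psi> (of_real (- r))"
  have \<phi>xy: "\<phi> x = of_real r" "\<phi> y = of_real (- r)"
    unfolding x_def y_def by (rule \<phi>\<psi>, use r in simp)+
  have mem: "\<psi> (of_real s) \<in> closed_segment a b \<inter> ball a \<epsilon> \<and> \<psi> (of_real s) \<noteq> a"
    if "\<bar>s\<bar> = r" for s
  proof -
    have s: "(of_real s :: complex) \<in> ball 0 1" "dist (of_real s :: complex) 0 < d"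
      using that r by auto
    have "(of_real s :: complex) \<in> \<phi> ` (closed_segment a b \<inter> U)"
      unfolding im using s by simp
    then obtain x where "x \<in> closed_segment a b" "x \<in> U" "\<phi> x = of_real s" by auto
    then have "\<psi> (of_real s) \<in> closed_segment a b" using \<psi>\<phi> by metis
    moreover have "\<psi> (of_real s) \<in> ball a \<epsilon>"
      using d(2)[OF s] \<psi>0 by (simp add: dist_commute)
    moreover have "\<psi> (of_real s) \<noteq> a"
    proof
      assume "\<psi> (of_real s) = a"
      then have "of_real s = (0::complex)" using \<phi>\<psi>[OF s(1)] *(4) by simp
      then show False using that r by simp
    qed
    ultimately show ?thesis by blast
  qed
  then have x: "x \<in> closed_segment a b \<inter> ball a \<epsilon>" "x \<noteq> a"
    and y: "y \<in> closed_segment a b \<inter> ball a \<epsilon>" "y \<noteq> a"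
    using mem[of r] mem[of "- r"] r(1) by (simp_all add: x_def y_def)
  let ?T = "closed_segment x y"
  have T_sub: "?T \<subseteq> closed_segment a b \<inter> U"
    using closed_segment_subset[of x "closed_segment a b \<inter> ball a \<epsilon>" y] x y \<epsilon>(2)
    by (auto simp: convex_Int)
  \<comment> \<open>Both points lie on the ray from \<open>a\<close> through \<open>b\<close> at
    positive parameters, and so does everything between them.\<close>
  have "a \<notin> ?T"
  proof
    assume "a \<in> ?T"
    have param: "\<exists>u>0. p = a + u *\<^sub>R (b - a)" if "p \<in> closed_segment a b" "p \<noteq> a" for p
    proof -
      obtain u where u: "0 \<le> u" "p = (1 - u) *\<^sub>R a + u *\<^sub>R b"
        using \<open>p \<in> closed_segment a b\<close> unfolding in_segment by blast
      moreover have "u \<noteq> 0" using u(2) \<open>p \<noteq> a\<close> by auto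
      moreover have "p = a + u *\<^sub>R (b - a)" unfolding u(2) by (simp add: algebra_simps)
      ultimately show ?thesis by (intro exI[of _ u]) simp
    qed
    obtain u where u: "0 < u" "x = a + u *\<^sub>R (b - a)" using param x by blast
    obtain v where v: "0 < v" "y = a + v *\<^sub>R (b - a)" using param y by blast
    obtain w where w: "0 \<le> w" "w \<le> 1" "a = (1 - w) *\<^sub>R x + w *\<^sub>R y"
      using \<open>a \<in> ?T\<close> unfolding closed_segment_def by auto
    have "(1 - w) *\<^sub>R x + w *\<^sub>R y = a + ((1 - w) * u + w * v) *\<^sub>R (b - a)"
      unfolding u(2) v(2) by (simp add: algebra_simps)
    with w(3) have "a = a + ((1 - w) * u + w * v) *\<^sub>R (b - a)" by (rule trans)
    then have "((1 - w) * u + w * v) *\<^sub>R (b - a) = 0"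
      by (rule iffD1[OF add_cancel_right_right])
    moreover have "b \<noteq> a" using x by auto
    ultimately have "(1 - w) * u + w * v = 0" by simp
    moreover have "0 \<le> (1 - w) * u" "0 \<le> w * v" using u(1) v(1) w(1,2) by simp_all
    ultimately have "(1 - w) * u = 0" "w * v = 0" by linarith+
    then show False using u(1) v(1) by simp
  qed
  have "continuous_on ?T \<phi>"
    using *(3) T_sub continuous_on_subset[of U \<phi> ?T] by (auto simp: homeomorphism_def)
  \<comment> \<open>The image contains \<open>r\<close> and \<open>- r\<close>, hence 0, but on the
    segment only \<open>a\<close> is mapped to the centre.\<close>
  then have "connected (Re ` \<phi> ` ?T)"
    by (intro connected_continuous_image continuous_on_Re continuous_on_id) auto
  moreover have "r \<in> Re ` \<phi> ` ?T" "- r \<in> Re ` \<phi> ` ?T"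
    using \<phi>xy by (force simp: image_iff)+
  ultimately have "0 \<in> Re ` \<phi> ` ?T"
    using r connectedD_interval[of "Re ` \<phi> ` ?T" "- r" r 0] by simp
  then obtain p where p: "p \<in> ?T" "Re (\<phi> p) = 0" by auto
  then have "\<phi> p \<in> {w \<in> ball 0 1. Im w = 0}" using T_sub im by blast
  then have "\<phi> p = 0" using p(2) by (simp add: complex_eq_iff)
  then have "p = a" using \<psi>\<phi>[of p] p(1) T_sub \<psi>0 by auto
  with p(1) \<open>a \<notin> ?T\<close> show False by simp
qed

lemma curves_cross_at_open_segment:
  assumes "curves_cross_at g h z" "path_image g = closed_segment a b"
  shows "z \<in> open_segment a b"
  using assms curves_cross_at_in_path_image[OF assms(1)] not_curves_cross_at_end[of g a b h]
    not_curves_cross_at_end[of g b a h]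
  by (auto simp: open_segment_def closed_segment_commute)

text \<open>The affine chart that sends \<alpha> to 0 and \<open>\<alpha> + d\<close> to 1 takes the
  segments to the intervals from -1 to 2 on the two axes, and these contain the diameters of the
  unit disc. The ratio 1 : 2 is the one in which the point 3 divides \<open>CA\<close> and
  \<open>BD\<close>.\<close>

lemma perpendicular_segments_cross:
  fixes \<alpha> d :: complex
  assumes "d \<noteq> 0" and g: "path_image g = closed_segment (\<alpha> - d) (\<alpha> + 2 * d)"
    and h: "path_image h = closed_segment (\<alpha> - \<i> * d) (\<alpha> + 2 * \<i> * d)"
  shows "curves_cross_at g h \<alpha>"
proof -
  define \<phi> \<psi> where "\<phi> w = (w - \<alpha>) / d" and "\<psi> v = \<alpha> + d * v" for w v
  have \<psi>\<phi>: "\<psi> (\<phi> w) = w" and \<phi>\<psi>: "\<phi> (\<psi> w) = w" for w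
    using assms(1) by (auto simp: \<phi>_def \<psi>_def)
  have dist: "norm (\<phi> w) < 1 \<longleftrightarrow> dist \<alpha> w < norm d" for w
    using assms(1) by (simp add: \<phi>_def norm_divide dist_norm norm_minus_commute)
  have hom: "homeomorphism (ball \<alpha> (norm d)) (ball 0 1) \<phi> \<psi>"
  proof (rule homeomorphismI)
    show "continuous_on (ball \<alpha> (norm d)) \<phi>" "continuous_on (ball 0 1) \<psi>"
      unfolding \<phi>_def \<psi>_def using assms(1) by (intro continuous_intros; simp)+
    show "\<phi> ` ball \<alpha> (norm d) \<subseteq> ball 0 1" using dist by auto
    show "\<psi> ` ball 0 1 \<subseteq> ball \<alpha> (norm d)" using dist[of "\<psi> _"] \<phi>\<psi> by auto
  qed (use \<phi>\<psi> \<psi>\<phi> in auto)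
  \<comment> \<open>\<open>3 * u - 1\<close> runs from -1 to 2 as \<open>u\<close> runs from 0 to
    1.\<close>
  have seg: "\<psi> v \<in> closed_segment (\<psi> (- c)) (\<psi> (2 * c)) \<longleftrightarrow>
      (\<exists>u. 0 \<le> u \<and> u \<le> 1 \<and> v = (3 * u - 1) *\<^sub>R c)" for v c
  proof -
    have "(\<psi> v = (1 - u) *\<^sub>R \<psi> (- c) + u *\<^sub>R \<psi> (2 * c)) \<longleftrightarrow> v = (3 * u - 1) *\<^sub>R c" for u
    proof -
      have "(\<psi> v = (1 - u) *\<^sub>R \<psi> (- c) + u *\<^sub>R \<psi> (2 * c)) \<longleftrightarrow> d * v = d * ((3 * u - 1) *\<^sub>R c)"
        unfolding \<psi>_def by (simp add: scaleR_conv_of_real algebra_simps)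
      then show ?thesis by (simp only: mult_left_cancel[OF assms(1)])
    qed
    then show ?thesis unfolding in_segment by simp
  qed
  have sub: "\<phi> ` (S \<inter> ball \<alpha> (norm d)) = {w \<in> ball 0 1. \<psi> w \<in> S}" for S
  proof (intro equalityI subsetI)
    fix w assume "w \<in> {w \<in> ball 0 1. \<psi> w \<in> S}"
    then show "w \<in> \<phi> ` (S \<inter> ball \<alpha> (norm d))"
      using dist[of "\<psi> w"] \<phi>\<psi> by (intro image_eqI[of _ _ "\<psi> w"]) auto
  qed (use dist \<psi>\<phi> in auto)
  have "\<phi> ` (path_image g \<inter> ball \<alpha> (norm d)) = {w \<in> ball 0 1. Im w = 0}"
  proof -
    have "(\<exists>u. 0 \<le> u \<and> u \<le> 1 \<and> w = (3 * u - 1) *\<^sub>R 1) \<longleftrightarrow> Im w = 0" if "norm w < 1" for w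
      using abs_Re_le_cmod[of w] that
      by (auto simp: complex_eq_iff field_simps intro!: exI[of _ "(Re w + 1) / 3"])
    moreover have "\<psi> w \<in> path_image g \<longleftrightarrow> (\<exists>u. 0 \<le> u \<and> u \<le> 1 \<and> w = (3 * u - 1) *\<^sub>R 1)" for w
      using seg[of w 1] unfolding g by (simp add: \<psi>_def mult.commute)
    ultimately show ?thesis unfolding sub by auto
  qed
  moreover have "\<phi> ` (path_image h \<inter> ball \<alpha> (norm d)) = {w \<in> ball 0 1. Re w = 0}"
  proof -
    have "(\<exists>u. 0 \<le> u \<and> u \<le> 1 \<and> w = (3 * u - 1) *\<^sub>R \<i>) \<longleftrightarrow> Re w = 0" if "norm w < 1" for w
      using abs_Im_le_cmod[of w] that
      by (auto simp: complex_eq_iff field_simps intro!: exI[of _ "(Im w + 1) / 3"])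
    moreover have "\<psi> w \<in> path_image h \<longleftrightarrow> (\<exists>u. 0 \<le> u \<and> u \<le> 1 \<and> w = (3 * u - 1) *\<^sub>R \<i>)" for w
      using seg[of w \<i>] unfolding h by (simp add: \<psi>_def mult.commute mult.left_commute)
    ultimately show ?thesis unfolding sub by auto
  qed
  ultimately show ?thesis
    unfolding curves_cross_at_def using hom assms(1)
    by (intro exI[of _ "ball \<alpha> (norm d)"] exI[of _ \<phi>] exI[of _ \<psi>]) (auto simp: \<phi>_def)
qed

section \<open>Edges and crossings of the whole drawing\<close>

definition open_edge :: "nat \<times> nat \<times> site \<times> site \<Rightarrow> complex set" where
  "open_edge = (\<lambda>(t, j, p, q). cell_map t j ` open_segment (site_point p) (site_point q))"

text \<open>By uniqueness of the cell coordinates both edges belong to the same trapezoid, where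
  \<open>open_site_edges_meet\<close> has compared all pairs.\<close>

lemma open_edges_meet:
  assumes "x \<in> edge_index k" "y \<in> edge_index k" "z \<in> open_edge x" "z \<in> open_edge y"
  shows "x = y \<or> (\<exists>t<k. \<exists>j<4. z = cell_map t j 3 \<and>
    (x = (t, j, A, C) \<and> y = (t, j, B, D) \<or> x = (t, j, B, D) \<and> y = (t, j, A, C)))"
proof -
  obtain t j p q where x: "x = (t, j, p, q)" by (cases x)
  obtain t' j' p' q' where y: "y = (t', j', p', q')" by (cases y)
  have j: "j < 4" "j' < 4" and pq: "(p, q) \<in> site_edges" "(p', q') \<in> site_edges"
    and t: "t < k \<or> p = I0"
    using assms(1,2) unfolding x y edge_index_def by auto
  obtain w where w: "w \<in> open_segment (site_point p) (site_point q)" "z = cell_map t j w"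
    using assms(3) unfolding x open_edge_def by auto
  obtain w' where w': "w' \<in> open_segment (site_point p') (site_point q')" "z = cell_map t' j' w'"
    using assms(4) unfolding y open_edge_def by auto
  have same: "t = t'" "j = j'" "w = w'"
    using cell_map_unique[of t j w t' j' w'] w w' j pq open_site_edge_in_cell by auto
  show ?thesis
    using open_site_edges_meet[OF pq w(1)] w'(1) same x y t j w(2) by auto
qed

lemma vertex_point_not_in_open_edge:
  assumes "x \<in> edge_index k"
  shows "vertex_point n \<notin> open_edge x"
proof
  assume n: "vertex_point n \<in> open_edge x"
  obtain t j p q where x: "x = (t, j, p, q)" by (cases x)
  have j: "j < 4" and pq: "(p, q) \<in> site_edges"
    using assms unfolding x edge_index_def by auto
  obtain w where w: "w \<in> open_segment (site_point p) (site_point q)" "vertex_point n = cell_map t j w"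
    using n unfolding x open_edge_def by auto
  obtain t' j' s where s: "j' < 4" "s \<in> vertex_sites" "n = label t' j' s" by (rule vertex_label)
  have "w = site_point s"
    using cell_map_unique[of t j w t' j' "site_point s"] w s j pq open_site_edge_in_cell
      vertex_site_in_cell vertex_point_label[of j' t' s] by auto
  then show False using site_not_in_open_edge s pq w by blast
qed

lemma edge_at_closed:
  assumes "(t, j, p, q) \<in> edge_index k"
  shows "vertex_point ` edge_at (t, j, p, q) = {cell_map t j (site_point p), cell_map t j (site_point q)}"
    "label t j p \<noteq> label t j q"
    "closed_segment (cell_map t j (site_point p)) (cell_map t j (site_point q)) =
      open_edge (t, j, p, q) \<union> vertex_point ` edge_at (t, j, p, q)"
proof -
  have "j < 4" "(p, q) \<in> site_edges" using assms by (auto simp: edge_index_def)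
  then show *: "vertex_point ` edge_at (t, j, p, q) = {cell_map t j (site_point p), cell_map t j (site_point q)}"
    by (simp add: edge_at_def vertex_point_label)
  have "site_point p \<noteq> site_point q" using \<open>(p, q) \<in> site_edges\<close> by (auto simp: site_edges_def)
  then show "label t j p \<noteq> label t j q"
    using vertex_point_label[OF \<open>j < 4\<close>] cell_map_inj by metis
  show "closed_segment (cell_map t j (site_point p)) (cell_map t j (site_point q)) =
      open_edge (t, j, p, q) \<union> vertex_point ` edge_at (t, j, p, q)"
    unfolding * open_edge_def prod.case cell_map_segment(2) by (auto simp: open_segment_def)
qed

text \<open>Equal ends give equal open segments. Distinct indices have common points only for a
  crossing pair, and such a pair has different ends.\<close>

lemma edge_at_eq:
  assumes "x \<in> edge_index k" "y \<in> edge_index k" "edge_at x = edge_at y"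
  shows "x = y"
proof (rule ccontr)
  assume "x \<noteq> y"
  obtain t j p q where x: "x = (t, j, p, q)" by (cases x)
  obtain t' j' p' q' where y: "y = (t', j', p', q')" by (cases y)
  have xk: "(t, j, p, q) \<in> edge_index k" and yk: "(t', j', p', q') \<in> edge_index k"
    using assms(1,2) x y by auto
  have "{cell_map t j (site_point p), cell_map t j (site_point q)} =
      {cell_map t' j' (site_point p'), cell_map t' j' (site_point q')}"
    using assms(3) edge_at_closed(1)[OF xk] edge_at_closed(1)[OF yk] x y by metis
  then have eq: "open_edge x = open_edge y"
    unfolding x y open_edge_def by (auto simp: cell_map_segment doubleton_eq_iff open_segment_commute)
  have "cell_map t j (site_point p) \<noteq> cell_map t j (site_point q)"
    using edge_at_closed(2)[OF xk] vertex_point_label cell_map_inj xk unfolding edge_index_def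
    by (metis (mono_tags, lifting) case_prodD injD mem_Collect_eq vertex_point_inj)
  then have "open_edge x \<noteq> {}"
    unfolding x open_edge_def by (simp add: cell_map_inj)
  then obtain z where "z \<in> open_edge x" by auto
  with open_edges_meet[OF assms(1,2), of z] eq \<open>x \<noteq> y\<close> obtain t j where
    "x = (t, j, A, C) \<and> y = (t, j, B, D) \<or> x = (t, j, B, D) \<and> y = (t, j, A, C)" "j < 4" by blast
  then show False using assms(3) by (auto simp: edge_at_def doubleton_eq_iff)
qed

lemma curve_edge_at:
  assumes "(t, j, p, q) \<in> edge_index k"
  shows "arc (curve chain_drawing (edge_at (t, j, p, q)))"
    "{pathstart (curve chain_drawing (edge_at (t, j, p, q))),
      pathfinish (curve chain_drawing (edge_at (t, j, p, q)))} = vertex_point ` edge_at (t, j, p, q)"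
    "path_image (curve chain_drawing (edge_at (t, j, p, q))) =
      closed_segment (cell_map t j (site_point p)) (cell_map t j (site_point q))"
proof -
  define m n where "m = label t j p" and "n = label t j q"
  have mn: "m \<noteq> n" and e: "edge_at (t, j, p, q) = {m, n}"
    using edge_at_closed(2)[OF assms] by (auto simp: m_def n_def edge_at_def)
  have "curve chain_drawing (edge_at (t, j, p, q)) = linepath (vertex_point (min m n)) (vertex_point (max m n))"
    by (simp add: chain_drawing_def e)
  moreover have "vertex_point m = cell_map t j (site_point p)" "vertex_point n = cell_map t j (site_point q)"
    using assms by (auto simp: m_def n_def vertex_point_label edge_index_def)
  ultimately show "arc (curve chain_drawing (edge_at (t, j, p, q)))"
    "{pathstart (curve chain_drawing (edge_at (t, j, p, q))),
      pathfinish (curve chain_drawing (edge_at (t, j, p, q)))} = vertex_point ` edge_at (t, j, p, q)"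
    "path_image (curve chain_drawing (edge_at (t, j, p, q))) =
      closed_segment (cell_map t j (site_point p)) (cell_map t j (site_point q))"
    using mn injD[OF vertex_point_inj, of "min m n" "max m n"]
    by (auto simp: e min_def max_def closed_segment_commute intro!: arc_linepath)
qed

lemma path_image_edge_at:
  assumes "x \<in> edge_index k"
  shows "path_image (curve chain_drawing (edge_at x)) = open_edge x \<union> vertex_point ` edge_at x"
  using assms curve_edge_at(3) edge_at_closed(3) by (cases x) auto

lemma curves_cross_at_open_edge:
  assumes "x \<in> edge_index k" "curves_cross_at (curve chain_drawing (edge_at x)) h z"
  shows "z \<in> open_edge x"
proof -
  obtain t j p q where x: "x = (t, j, p, q)" by (cases x)
  show ?thesis
    using curves_cross_at_open_segment[OF assms(2)] curve_edge_at(3) assms(1)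
    unfolding x open_edge_def by (auto simp: cell_map_segment)
qed

lemma crossing_pair_cross:
  assumes "t < k" "j < 4"
  shows "curves_cross_at (curve chain_drawing (edge_at (t, j, A, C)))
    (curve chain_drawing (edge_at (t, j, B, D))) (cell_map t j 3)"
proof (rule perpendicular_segments_cross)
  \<comment> \<open>Before scaling and turning, with \<open>d = 1 - \<i>\<close>:
    \<open>C = 3 - d\<close>, \<open>A = 3 + 2 * d\<close>, \<open>B = 3 - \<i> * d\<close> and
    \<open>D = 3 + 2 * \<i> * d\<close>.\<close>
  let ?d = "cell_map t j (Complex 1 (-1))"
  show "?d \<noteq> 0" by (simp add: cell_map_def) (simp add: complex_eq_iff)
  have idx: "(t, j, A, C) \<in> edge_index k" "(t, j, B, D) \<in> edge_index k"
    using assms by (auto simp: edge_index_def site_edges_def)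
  have 1: "cell_map t j a - cell_map t j b = cell_map t j (a - b)"
    "cell_map t j a + 2 * cell_map t j b = cell_map t j (a + 2 * b)"
    "\<i> * cell_map t j a = cell_map t j (\<i> * a)" for a b
    by (simp_all add: cell_map_def algebra_simps)
  have 2: "3 - Complex 1 (-1) = site_point C" "3 + 2 * Complex 1 (-1) = site_point A"
    "3 - \<i> * Complex 1 (-1) = site_point B" "3 + 2 * (\<i> * Complex 1 (-1)) = site_point D"
    by (simp_all add: complex_eq_iff)
  show "path_image (curve chain_drawing (edge_at (t, j, A, C))) =
      closed_segment (cell_map t j 3 - ?d) (cell_map t j 3 + 2 * ?d)"
    unfolding curve_edge_at(3)[OF idx(1)] 1 2 by (rule closed_segment_commute)
  show "path_image (curve chain_drawing (edge_at (t, j, B, D))) =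
      closed_segment (cell_map t j 3 - \<i> * ?d) (cell_map t j 3 + 2 * \<i> * ?d)"
    unfolding curve_edge_at(3)[OF idx(2)] mult.assoc 1 2 ..
qed

text \<open>Segments cross only in their open parts, so \<open>open_edges_meet\<close> leaves no
  other candidates.\<close>

lemma edges_cross_at_chain:
  "edges_cross_at (chain_graph k) chain_drawing e f z \<longleftrightarrow>
    (\<exists>t<k. \<exists>j<4. z = cell_map t j 3 \<and>
      (e = edge_at (t, j, A, C) \<and> f = edge_at (t, j, B, D) \<or>
       e = edge_at (t, j, B, D) \<and> f = edge_at (t, j, A, C)))" (is "?L \<longleftrightarrow> ?R")
proof
  assume ?L
  then have "e \<in> edge_at ` edge_index k" "f \<in> edge_at ` edge_index k" "e \<noteq> f"
    and cross: "curves_cross_at (curve chain_drawing e) (curve chain_drawing f) z"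
    by (simp_all add: edges_cross_at_def chain_graph_def)
  then obtain x y where x: "x \<in> edge_index k" "e = edge_at x"
    and y: "y \<in> edge_index k" "f = edge_at y" and "x \<noteq> y" by blast
  have "z \<in> open_edge x" "z \<in> open_edge y"
    using curves_cross_at_open_edge x y cross curves_cross_at_sym[OF cross] by blast+
  from open_edges_meet[OF x(1) y(1) this] \<open>x \<noteq> y\<close> x(2) y(2) show ?R by metis
next
  assume ?R
  then obtain t j where tj: "t < k" "j < 4" "z = cell_map t j 3"
    "e = edge_at (t, j, A, C) \<and> f = edge_at (t, j, B, D) \<or>
     e = edge_at (t, j, B, D) \<and> f = edge_at (t, j, A, C)" by auto
  have idx: "(t, j, A, C) \<in> edge_index k" "(t, j, B, D) \<in> edge_index k"
    using tj by (auto simp: edge_index_def site_edges_def)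
  have "edge_at (t, j, A, C) \<noteq> edge_at (t, j, B, D)" using edge_at_eq[OF idx] by auto
  then show ?L
    using tj idx crossing_pair_cross[OF tj(1,2)] curves_cross_at_sym[OF crossing_pair_cross[OF tj(1,2)]]
    unfolding edges_cross_at_def chain_graph_def by auto
qed

section \<open>The drawing is bipartite and IC-plane\<close>

lemma label_inj:
  assumes "label t j s = label t' j' s'" "j < 4" "j' < 4" "s \<in> vertex_sites" "s' \<in> vertex_sites"
  shows "t = t'" "j = j'" "s = s'"
proof -
  have "cell_map t j (site_point s) = cell_map t' j' (site_point s')"
    using assms vertex_point_label by metis
  from cell_map_unique[OF this] show "t = t'" "j = j'" "s = s'"
    using assms vertex_site_in_cell inj_onD[OF site_point_inj_on] by auto
qed

lemma edge_at_verts: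
  assumes "x \<in> edge_index k"
  shows "edge_at x \<subseteq> {..<24 * k + 4}" "card (edge_at x) = 2"
    "\<exists>m n. even m \<and> odd n \<and> edge_at x = {m, n}"
proof -
  obtain t j p q where x: "x = (t, j, p, q)" by (cases x)
  have "j < 4" "(p, q) \<in> site_edges" "t < k \<or> t = k \<and> p = I0 \<and> q = I1"
    using assms unfolding x edge_index_def by auto
  then show "edge_at x \<subseteq> {..<24 * k + 4}"
    unfolding x edge_at_def site_edges_def by auto
  show "card (edge_at x) = 2"
    using edge_at_closed(2) assms by (auto simp: x edge_at_def card_2_iff)
  have "even (label t j p) \<noteq> even (label t j q)"
    using \<open>j < 4\<close> \<open>(p, q) \<in> site_edges\<close> unfolding site_edges_def less4_cases by auto
  then show "\<exists>m n. even m \<and> odd n \<and> edge_at x = {m, n}"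
    unfolding x edge_at_def by auto
qed

lemma simple_chain_graph: "simple_graph (chain_graph k)"
  using edge_at_verts by (auto simp: simple_graph_def chain_graph_def)

lemma bipartite_chain_graph: "bipartite_graph (chain_graph k)"
  unfolding bipartite_graph_def
proof (intro conjI exI)
  show "{n \<in> verts (chain_graph k). even n} \<union> {n \<in> verts (chain_graph k). odd n} = verts (chain_graph k)"
    by auto
  show "{n \<in> verts (chain_graph k). even n} \<inter> {n \<in> verts (chain_graph k). odd n} = {}" by auto
  show "\<forall>e\<in>edges (chain_graph k). \<exists>a\<in>{n \<in> verts (chain_graph k). even n}.
      \<exists>b\<in>{n \<in> verts (chain_graph k). odd n}. e = {a, b}"
  proof
    fix e assume "e \<in> edges (chain_graph k)"
    then obtain x where "x \<in> edge_index k" "e = edge_at x" by (auto simp: chain_graph_def)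
    with edge_at_verts[of x k] show "\<exists>a\<in>{n \<in> verts (chain_graph k). even n}.
      \<exists>b\<in>{n \<in> verts (chain_graph k). odd n}. e = {a, b}"
      by (fastforce simp: chain_graph_def)
  qed
qed (rule simple_chain_graph)

lemma card_edges_chain_graph: "card (edges (chain_graph k)) = 52 * k + 4"
proof -
  have "edge_index k = {..<k} \<times> {..<4} \<times> site_edges \<union> {k} \<times> {..<4} \<times> {(I0, I1)}"
    by (auto simp: edge_index_def site_edges_def)
  moreover have "card site_edges = 13" "finite site_edges" by (simp_all add: site_edges_def)
  moreover have "({..<k} \<times> {..<4::nat} \<times> site_edges) \<inter> ({k} \<times> {..<4} \<times> {(I0, I1)}) = {}" by auto
  ultimately have "card (edge_index k) = 52 * k + 4"
    by (simp only:) (subst card_Un_disjoint, simp_all add: card_cartesian_product)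
  moreover have "inj_on edge_at (edge_index k)" using edge_at_eq by (auto simp: inj_on_def)
  ultimately show ?thesis by (simp add: chain_graph_def card_image)
qed

lemma chain_drawing_is_drawing: "is_drawing (chain_graph k) chain_drawing"
  unfolding is_drawing_def
proof (intro conjI ballI impI)
  show "inj_on (pos chain_drawing) (verts (chain_graph k))"
    using vertex_point_inj by (auto simp: chain_drawing_def inj_on_def inj_def)
next
  fix e assume "e \<in> edges (chain_graph k)"
  then obtain x where x: "x \<in> edge_index k" "e = edge_at x" by (auto simp: chain_graph_def)
  have pos: "pos chain_drawing = vertex_point" by (simp add: chain_drawing_def)
  show "arc (curve chain_drawing e)"
    "{pathstart (curve chain_drawing e), pathfinish (curve chain_drawing e)} = pos chain_drawing ` e"
    using curve_edge_at x by (cases x; auto simp: pos)+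
  show "path_image (curve chain_drawing e) \<inter> pos chain_drawing ` verts (chain_graph k) = pos chain_drawing ` e"
    unfolding x(2) path_image_edge_at[OF x(1)] pos
    using vertex_point_not_in_open_edge[OF x(1)] edge_at_verts(1)[OF x(1)]
    by (auto simp: chain_graph_def)
  fix f z assume "f \<in> edges (chain_graph k)" "e \<noteq> f"
    and z: "z \<in> path_image (curve chain_drawing e) \<inter> path_image (curve chain_drawing f)"
  then obtain y where y: "y \<in> edge_index k" "f = edge_at y" by (auto simp: chain_graph_def)
  have "z \<in> open_edge x \<union> vertex_point ` e" "z \<in> open_edge y \<union> vertex_point ` f"
    using z path_image_edge_at x y by auto
  then consider "z \<in> open_edge x" "z \<in> open_edge y" | "z \<in> vertex_point ` e" "z \<in> vertex_point ` f"
    using vertex_point_not_in_open_edge x(1) y(1) by blast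
  then show "z \<in> pos chain_drawing ` (e \<inter> f) \<or> edges_cross_at (chain_graph k) chain_drawing e f z"
  proof cases
    case 1
    with open_edges_meet[OF x(1) y(1)] \<open>e \<noteq> f\<close> x(2) y(2) show ?thesis
      unfolding edges_cross_at_chain by metis
  next
    case 2
    then show ?thesis using vertex_point_inj by (auto simp: pos inj_def)
  qed
qed

lemma three_in_cell: "3 \<in> cell"
  by (simp add: cell_def)

lemma crossing_ends_chain:
  assumes "t < k" "j < 4"
  shows "crossing_ends (chain_graph k) chain_drawing (cell_map t j 3) = label t j ` {A, B, C, D}"
proof -
  have "{e. \<exists>f. edges_cross_at (chain_graph k) chain_drawing e f (cell_map t j 3)} =
      {edge_at (t, j, A, C), edge_at (t, j, B, D)}"
    unfolding edges_cross_at_chain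
    using assms cell_map_unique[OF _ three_in_cell three_in_cell] by blast
  then show ?thesis unfolding crossing_ends_def by (auto simp: edge_at_def)
qed

lemma crossings_chain: "crossings (chain_graph k) chain_drawing = {cell_map t j 3 | t j. t < k \<and> j < 4}"
  unfolding crossings_def edges_cross_at_chain by blast

lemma chain_IC_plane: "IC_plane_graph (chain_graph k) chain_drawing"
proof -
  have disj: "edge_at (t, j, A, C) \<inter> edge_at (t, j, B, D) = {}" if "j < 4" for t j
    using label_inj[of t j _ t j _] that by (auto simp: edge_at_def vertex_sites_def)
  have eq: "e = edge_at (t, j, A, C) \<or> e = edge_at (t, j, B, D) \<Longrightarrow>
      e = edge_at (t', j', A, C) \<or> e = edge_at (t', j', B, D) \<Longrightarrow> t < k \<Longrightarrow> t' < k \<Longrightarrow> j < 4 \<Longrightarrow> j' < 4 \<Longrightarrow>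
      t = t' \<and> j = j'" for e t j t' j'
  proof -
    have idx: "(t, j, p, q) \<in> edge_index k" if "t < k" "j < 4" "(p, q) \<in> {(A, C), (B, D)}" for t j p q
      using that by (auto simp: edge_index_def site_edges_def)
    fix e t j t' j' assume "t < k" "t' < k" "j < 4" "j' < 4" and
      "e = edge_at (t, j, A, C) \<or> e = edge_at (t, j, B, D)"
      "e = edge_at (t', j', A, C) \<or> e = edge_at (t', j', B, D)"
    then obtain p q p' q' where pq: "(p, q) \<in> {(A, C), (B, D)}" "(p', q') \<in> {(A, C), (B, D)}"
      "e = edge_at (t, j, p, q)" "e = edge_at (t', j', p', q')" by blast
    have "(t, j, p, q) = (t', j', p', q')"
      by (rule edge_at_eq[of _ k]) (use pq idx \<open>t < k\<close> \<open>t' < k\<close> \<open>j < 4\<close> \<open>j' < 4\<close> in auto)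
    then show "t = t' \<and> j = j'" by simp
  qed
  have "good_drawing (chain_graph k) chain_drawing"
    unfolding good_drawing_def
  proof (intro conjI allI impI)
    show "is_drawing (chain_graph k) chain_drawing" by (rule chain_drawing_is_drawing)
    show "z = z'" if "edges_cross_at (chain_graph k) chain_drawing e f z \<and>
      edges_cross_at (chain_graph k) chain_drawing e f z'" for e f z z'
      using that eq unfolding edges_cross_at_chain by blast
    show "e \<inter> f = {}" if "edges_cross_at (chain_graph k) chain_drawing e f z" for e f z
      using that disj unfolding edges_cross_at_chain by blast
  qed
  moreover have "f = f' \<and> z = z'" if cross: "edges_cross_at (chain_graph k) chain_drawing e f z"
      "edges_cross_at (chain_graph k) chain_drawing e f' z'" for e f f' z z'
  proof -
    obtain t j where 1: "t < k" "j < 4" "z = cell_map t j 3"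
      "e = edge_at (t, j, A, C) \<and> f = edge_at (t, j, B, D) \<or>
       e = edge_at (t, j, B, D) \<and> f = edge_at (t, j, A, C)"
      using cross(1) unfolding edges_cross_at_chain by blast
    obtain t' j' where 2: "t' < k" "j' < 4" "z' = cell_map t' j' 3"
      "e = edge_at (t', j', A, C) \<and> f' = edge_at (t', j', B, D) \<or>
       e = edge_at (t', j', B, D) \<and> f' = edge_at (t', j', A, C)"
      using cross(2) unfolding edges_cross_at_chain by blast
    have same: "t = t'" "j = j'" using eq[of e t j t' j'] 1 2 by blast+
    have "edge_at (t, j, A, C) \<noteq> edge_at (t, j, B, D)" using disj[of j t] 1 by (auto simp: edge_at_def)
    then show ?thesis using 1 2 same by metis
  qed
  moreover have "crossing_ends (chain_graph k) chain_drawing \<alpha> \<inter> crossing_ends (chain_graph k) chain_drawing \<beta> = {}"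
    if \<alpha>\<beta>: "\<alpha> \<in> crossings (chain_graph k) chain_drawing" "\<beta> \<in> crossings (chain_graph k) chain_drawing" "\<alpha> \<noteq> \<beta>" for \<alpha> \<beta>
  proof -
    obtain t j t' j' where *: "t < k" "j < 4" "t' < k" "j' < 4" "\<alpha> = cell_map t j 3" "\<beta> = cell_map t' j' 3"
      using \<alpha>\<beta>(1,2) unfolding crossings_chain by auto
    have sub: "{A, B, C, D} \<subseteq> vertex_sites" by (auto simp: vertex_sites_def)
    show ?thesis
    proof (rule ccontr)
      assume "\<not> ?thesis"
      then obtain s s' where "s \<in> {A, B, C, D}" "s' \<in> {A, B, C, D}" "label t j s = label t' j' s'"
        unfolding *(5,6) crossing_ends_chain[OF *(1,2)] crossing_ends_chain[OF *(3,4)] by blast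
      with sub have "t = t'" "j = j'" using label_inj[of t j s t' j' s'] * by auto
      with * \<alpha>\<beta>(3) show False by simp
    qed
  qed
  ultimately show ?thesis
    unfolding IC_plane_graph_def one_plane_graph_def using simple_chain_graph by blast
qed

section \<open>4-connectivity\<close>

definition link :: "nat ugraph \<Rightarrow> nat set \<Rightarrow> nat \<Rightarrow> nat \<Rightarrow> bool" where
  "link G S a b \<longleftrightarrow> {a, b} \<in> edges G \<and> a \<notin> S \<and> b \<notin> S"

lemma link_sym: "(link G S)\<^sup>*\<^sup>* a b \<Longrightarrow> (link G S)\<^sup>*\<^sup>* b a"
  by (rule sympD[OF symp_rtranclp]) (auto simp: symp_def link_def insert_commute)

text \<open>Paths move along a graph homomorphism if the deleted set is pulled back. This is applied
  to quarter turns and to shifts by whole layers.\<close>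

lemma link_map:
  assumes "(link G {n. f n \<in> S})\<^sup>*\<^sup>* a b"
    and "\<And>a b. {a, b} \<in> edges G \<Longrightarrow> {f a, f b} \<in> edges H"
  shows "(link H S)\<^sup>*\<^sup>* (f a) (f b)"
  using assms(1) by (induction rule: rtranclp_induct) (auto simp: link_def assms(2) intro: rtranclp.rtrancl_into_rtrancl)

lemma link_path:
  assumes "successively (\<lambda>a b. {a, b} \<in> edges G) (x # p)" "set (x # p) \<inter> S = {}"
  shows "(link G S)\<^sup>*\<^sup>* x (last (x # p))"
  using assms
proof (induction p arbitrary: x)
  case (Cons y p)
  then have "link G S x y" by (auto simp: link_def)
  moreover have "(link G S)\<^sup>*\<^sup>* y (last (y # p))" using Cons by auto
  ultimately show ?case by (auto intro: converse_rtranclp_into_rtranclp)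
qed simp

text \<open>If every list met \<open>S\<close>, disjointness would provide as many elements of
  \<open>S\<close> as there are lists.\<close>

lemma disjoint_list_avoids:
  assumes "finite S" "card S < length ps" "distinct (concat ps)"
  obtains p where "p \<in> set ps" "set p \<inter> S = {}"
proof (rule ccontr)
  assume "\<not> thesis"
  with that have hit: "\<forall>p\<in>set ps. \<exists>s. s \<in> set p \<inter> S" by blast
  have "length ps \<le> card (set (concat ps) \<inter> S)"
    using assms(3) hit
  proof (induction ps)
    case (Cons p ps)
    then have "0 < card (set p \<inter> S)" by (auto simp: card_gt_0_iff)
    moreover have "set (concat (p # ps)) \<inter> S = (set p \<inter> S) \<union> (set (concat ps) \<inter> S)" by auto
    moreover have "card ((set p \<inter> S) \<union> (set (concat ps) \<inter> S)) = card (set p \<inter> S) + card (set (concat ps) \<inter> S)"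
      using Cons.prems by (intro card_Un_disjoint) auto
    moreover have "length ps \<le> card (set (concat ps) \<inter> S)" using Cons by auto
    ultimately show ?case by simp
  qed simp
  also have "\<dots> \<le> card S" using assms(1) by (intro card_mono) auto
  finally show False using assms(2) by simp
qed

section \<open>Shifts by layers and quarter turns, acting on vertex numbers\<close>

lemma label_shift: "24 * t + label t' j s = label (t + t') j s"
  by (cases s) auto

text \<open>The quarter turns permute each group of four numbers with the same quotient by 4; such a
  group is one orbit.\<close>

definition rot :: "nat \<Rightarrow> nat \<Rightarrow> nat" where
  "rot j n = 4 * (n div 4) + (n + j) mod 4"

lemma rot_add: "m < 4 \<Longrightarrow> rot j (4 * q + m) = 4 * q + (m + j) mod 4"
proof -
  assume "m < 4"
  then have "(4 * q + m) div 4 = q" by simp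
  moreover have "(4 * q + m + j) mod 4 = (m + j) mod 4" by (simp add: add.assoc)
  ultimately show ?thesis unfolding rot_def by simp
qed

lemma rot_label:
  assumes "j < 4" "j' < 4"
  shows "rot j (label t j' s) = label t ((j' + j) mod 4) s"
proof -
  have rot: "rot j (4 * (6 * t + q) + (j' + c) mod 4) = 4 * (6 * t + q) + ((j' + j) mod 4 + c) mod 4" for q c
  proof -
    have "((j' + c) mod 4 + j) mod 4 = ((j' + j) mod 4 + c) mod 4"
      unfolding mod_add_left_eq by (simp only: add.assoc add.commute[of c])
    then show ?thesis by (simp only: rot_add pos_mod_bound mod_less_divisor zero_less_numeral)
  qed
  show ?thesis
  proof (cases s)
    case I0 then show ?thesis using rot[of 0 0] assms by (simp add: distrib_left add_ac)
  next
    case I1 then show ?thesis using rot[of 0 1] assms by (simp add: distrib_left add_ac)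
  next
    case M0 then show ?thesis using rot[of 1 0] assms by (simp add: distrib_left add_ac)
  next
    case M1 then show ?thesis using rot[of 1 1] assms by (simp add: distrib_left add_ac)
  next
    case B then show ?thesis using rot[of 2 1] assms by (simp add: distrib_left add_ac)
  next
    case C then show ?thesis using rot[of 3 0] assms by (simp add: distrib_left add_ac)
  next
    case A then show ?thesis using rot[of 4 1] assms by (simp add: distrib_left add_ac)
  next
    case D then show ?thesis using rot[of 5 0] assms by (simp add: distrib_left add_ac)
  next
    case O0 then show ?thesis using rot[of 6 0] assms by (simp add: distrib_left add_ac)
  next
    case O1 then show ?thesis using rot[of 6 1] assms by (simp add: distrib_left add_ac)
  next
    case Cp then show ?thesis using rot[of 3 3] assms by (simp add: distrib_left add_ac)
  next
    case Dp then show ?thesis using rot[of 5 3] assms by (simp add: distrib_left add_ac)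
  qed
qed

lemma rot_inj: "inj (rot j)"
proof (rule injI)
  fix m n assume eq: "rot j m = rot j n"
  then have "rot j m div 4 = rot j n div 4" "rot j m mod 4 = rot j n mod 4" by auto
  then have "m div 4 = n div 4" "(m + j) mod 4 = (n + j) mod 4" unfolding rot_def by auto
  \<comment> \<open>Adding \<open>3 * j\<close> completes the shift to \<open>4 * j\<close>, which
    vanishes modulo 4.\<close>
  moreover from this(2) have "(m + j + 3 * j) mod 4 = (n + j + 3 * j) mod 4"
    by (metis mod_add_left_eq)
  then have "m mod 4 = n mod 4" by (simp add: add.assoc)
  ultimately show "m = n" by (metis div_mult_mod_eq)
qed

lemma edges_shift:
  assumes "{a, b} \<in> edges (chain_graph 1)" "t < k"
  shows "{24 * t + a, 24 * t + b} \<in> edges (chain_graph k)"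
proof -
  obtain t' j p q where x: "(t', j, p, q) \<in> edge_index 1" "{a, b} = edge_at (t', j, p, q)"
    using assms(1) by (auto simp: chain_graph_def)
  have "{24 * t + a, 24 * t + b} = (\<lambda>n. 24 * t + n) ` {a, b}" by simp
  also have "\<dots> = edge_at (t + t', j, p, q)" unfolding x(2) by (simp add: edge_at_def label_shift)
  moreover have "(t + t', j, p, q) \<in> edge_index k"
    using x(1) assms(2) by (auto simp: edge_index_def site_edges_def)
  ultimately show ?thesis by (auto simp: chain_graph_def)
qed

lemma edges_rot:
  assumes "{a, b} \<in> edges (chain_graph k)" "j < 4"
  shows "{rot j a, rot j b} \<in> edges (chain_graph k)"
proof -
  obtain t j' p q where x: "(t, j', p, q) \<in> edge_index k" "{a, b} = edge_at (t, j', p, q)"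
    using assms(1) by (auto simp: chain_graph_def)
  have "j' < 4" using x(1) by (simp add: edge_index_def)
  have "{rot j a, rot j b} = rot j ` {a, b}" by simp
  also have "\<dots> = edge_at (t, (j' + j) mod 4, p, q)"
    unfolding x(2) using assms(2) \<open>j' < 4\<close> by (simp add: edge_at_def rot_label)
  moreover have "(t, (j' + j) mod 4, p, q) \<in> edge_index k"
    using x(1) by (auto simp: edge_index_def)
  ultimately show ?thesis by (auto simp: chain_graph_def)
qed

text \<open>The 56 edges of one block as explicit pairs, against which the certificate paths are
  checked by simplification.\<close>

definition block_links :: "(nat \<times> nat) list" where
  "block_links = [(0,1), (0,9), (9,12), (12,1), (4,9), (12,5), (4,17), (17,20), (20,5), (17,12), (9,20),
     (17,24), (20,25), (1,2), (1,10), (10,13), (13,2), (5,10), (13,6), (5,18), (18,21), (21,6),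
     (18,13), (10,21), (18,25), (21,26), (2,3), (2,11), (11,14), (14,3), (6,11), (14,7),
     (6,19), (19,22), (22,7), (19,14), (11,22), (19,26), (22,27), (3,0), (3,8), (8,15), (15,0),
     (7,8), (15,4), (7,16), (16,23), (23,4), (16,15), (8,23), (16,27), (23,24), (24,25),
     (25,26), (26,27), (27,24)]"

lemma block_links_edges:
  assumes "(a, b) \<in> set block_links"
  shows "{a, b} \<in> edges (chain_graph 1)" "{b, a} \<in> edges (chain_graph 1)"
proof -
  have "edge_at (0, j, p, q) \<in> edges (chain_graph 1)" if "j < 4" "(p, q) \<in> site_edges" for j p q
    using that by (auto simp: chain_graph_def edge_index_def)
  then have "\<forall>j\<in>{0, 1, 2, 3}. \<forall>(p, q)\<in>site_edges. {label 0 j p, label 0 j q} \<in> edges (chain_graph 1)"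
    by (auto simp: edge_at_def)
  moreover have ring: "edge_at (1, j, I0, I1) \<in> edges (chain_graph 1)" if "j < 4" for j
    using that by (auto simp: chain_graph_def edge_index_def site_edges_def)
  have "\<forall>j\<in>{0, 1, 2, 3}. {label 1 j I0, label 1 j I1} \<in> edges (chain_graph 1)"
  proof
    fix j :: nat assume "j \<in> {0, 1, 2, 3}"
    then have "j < 4" by auto
    from ring[OF this] show "{label 1 j I0, label 1 j I1} \<in> edges (chain_graph 1)"
      by (simp only: edge_at_def prod.case)
  qed
  ultimately have "\<forall>(a, b)\<in>set block_links. {a, b} \<in> edges (chain_graph 1)"
    unfolding block_links_def site_edges_def by (simp flip: numeral_2_eq_2)
  then show "{a, b} \<in> edges (chain_graph 1)" using assms by blast
  then show "{b, a} \<in> edges (chain_graph 1)" by (simp add: insert_commute)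
qed

abbreviation block_adj :: "nat \<Rightarrow> nat \<Rightarrow> bool" where
  "block_adj a b \<equiv> (a, b) \<in> set block_links \<or> (b, a) \<in> set block_links"

lemma block_path:
  assumes "successively block_adj (x # p)" "set (x # p) \<inter> S = {}"
  shows "(link (chain_graph 1) S)\<^sup>*\<^sup>* x (last (x # p))"
  by (rule link_path) (use assms block_links_edges in \<open>auto elim!: successively_mono\<close>)

text \<open>The lists are four paths from \<open>x\<close> without common vertices beyond
  \<open>x\<close>, and fewer than four deleted vertices cannot hit them all. The targets 4 to 7 are
  the vertices at the sites \<open>M0\<close>.\<close>

lemma fan_to_middle:
  assumes "finite S" "card S < 4" "x \<notin> S" "length ps = 4" "distinct (concat ps)"
    "\<forall>p\<in>set ps. successively block_adj (x # p) \<and> p \<noteq> [] \<and> last p \<in> {4, 5, 6, 7}"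
  shows "\<exists>m\<in>{4, 5, 6, 7}. m \<notin> S \<and> (link (chain_graph 1) S)\<^sup>*\<^sup>* x m"
proof -
  obtain p where p: "p \<in> set ps" "set p \<inter> S = {}"
    using disjoint_list_avoids[of S ps] assms by auto
  then have "(link (chain_graph 1) S)\<^sup>*\<^sup>* x (last p)"
    using block_path[of x p S] assms by auto
  moreover have "last p \<in> {4, 5, 6, 7}" "last p \<notin> S" using p assms(6) last_in_set by blast+
  ultimately show ?thesis by blast
qed

text \<open>\<open>ps\<close> holds only the interiors of the paths, so distinctness of
  \<open>concat ps\<close> makes them internally disjoint.\<close>

lemma disjoint_paths_link:
  assumes "finite S" "card S < 4" "x \<notin> S" "y \<notin> S" "length ps = 4" "distinct (concat ps)"
    "\<forall>p\<in>set ps. successively block_adj (x # p @ [y])"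
  shows "(link (chain_graph 1) S)\<^sup>*\<^sup>* x y"
proof -
  obtain p where "p \<in> set ps" "set p \<inter> S = {}"
    using disjoint_list_avoids[of S ps] assms by auto
  then show ?thesis using block_path[of x "p @ [y]" S] assms by auto
qed

text \<open>One representative of each rotation orbit of the block outside the middle
  square.\<close>

lemma base_fans:
  assumes "finite S" "card S < 4" "x \<notin> S" "x \<in> {0, 8, 12, 16, 20, 24}"
  shows "\<exists>m\<in>{4, 5, 6, 7}. m \<notin> S \<and> (link (chain_graph 1) S)\<^sup>*\<^sup>* x m"
proof -
  have 0: ?thesis if "x = 0"
    by (rule fan_to_middle[OF assms(1-3), of "[[1, 12, 5], [3, 2, 11, 6], [9, 4], [15, 8, 7]]"])
       (simp_all add: that block_links_def)
  have 8: ?thesis if "x = 8"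
    by (rule fan_to_middle[OF assms(1-3), of "[[3, 2, 11, 6], [7], [23, 4], [15, 0, 9, 12, 5]]"])
       (simp_all add: that block_links_def)
  have 12: ?thesis if "x = 12"
    by (rule fan_to_middle[OF assms(1-3), of "[[9, 4], [5], [1, 2, 11, 6], [17, 24, 23, 16, 7]]"])
       (simp_all add: that block_links_def)
  have 16: ?thesis if "x = 16"
    by (rule fan_to_middle[OF assms(1-3), of "[[27, 26, 21, 6], [23, 4], [15, 0, 9, 12, 5], [7]]"])
       (simp_all add: that block_links_def)
  have 20: ?thesis if "x = 20"
    by (rule fan_to_middle[OF assms(1-3), of "[[17, 24, 23, 16, 7], [5], [9, 4], [25, 18, 21, 6]]"])
       (simp_all add: that block_links_def)
  have 24: ?thesis if "x = 24"
    by (rule fan_to_middle[OF assms(1-3), of "[[17, 4], [27, 26, 21, 6], [25, 18, 5], [23, 16, 7]]"])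
       (simp_all add: that block_links_def)
  show ?thesis using assms(4) 0 8 12 16 20 24 by blast
qed

text \<open>One side and one diagonal of the middle square; rotations yield the other pairs.\<close>

lemma base_paths:
  assumes "finite S" "card S < 4" "4 \<notin> S" "y \<notin> S" "y \<in> {5, 6}"
  shows "(link (chain_graph 1) S)\<^sup>*\<^sup>* 4 y"
proof -
  have 5: ?thesis if "y = 5"
    by (rule disjoint_paths_link[OF assms(1-4), of "[[9, 12], [23, 24, 25, 18], [17, 20], [15, 0, 1, 10]]"])
       (simp_all add: that block_links_def)
  have 6: ?thesis if "y = 6"
    by (rule disjoint_paths_link[OF assms(1-4), of "[[9, 0, 1, 10, 13], [23, 16, 7, 14, 19], [17, 12, 5, 18, 21], [15, 8, 3, 2, 11]]"])
       (simp_all add: that block_links_def)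
  show ?thesis using assms(5) 5 6 by blast
qed

lemma link_rot:
  assumes "finite S" "card S < 4" "j < 4"
  shows "finite {n. rot j n \<in> S}" "card {n. rot j n \<in> S} < 4"
    "(link (chain_graph 1) {n. rot j n \<in> S})\<^sup>*\<^sup>* a b \<Longrightarrow> (link (chain_graph 1) S)\<^sup>*\<^sup>* (rot j a) (rot j b)"
proof -
  show "finite {n. rot j n \<in> S}" using finite_vimageI[OF assms(1) rot_inj] by (simp add: vimage_def)
  have "card {n. rot j n \<in> S} \<le> card S"
    by (rule card_inj_on_le[of "rot j"]) (use rot_inj assms(1) in \<open>auto simp: inj_on_def inj_def\<close>)
  then show "card {n. rot j n \<in> S} < 4" using assms(2) by simp
  show "(link (chain_graph 1) S)\<^sup>*\<^sup>* (rot j a) (rot j b)"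
    if "(link (chain_graph 1) {n. rot j n \<in> S})\<^sup>*\<^sup>* a b"
    by (rule link_map[OF that]) (rule edges_rot[OF _ assms(3)])
qed

lemma block_to_middle:
  assumes "finite S" "card S < 4" "x \<notin> S" "x < 28"
  shows "\<exists>m\<in>{4, 5, 6, 7}. m \<notin> S \<and> (link (chain_graph 1) S)\<^sup>*\<^sup>* x m"
proof (cases "x div 4 = 1")
  case True
  then have "x \<in> {4, 5, 6, 7}" by auto
  then show ?thesis using assms(3) by blast
next
  case False
  define j y where "j = x mod 4" and "y = 4 * (x div 4)"
  have x: "x = rot j y" and "j < 4" unfolding j_def y_def rot_def by auto
  have "x div 4 = 0 \<or> x div 4 = 2 \<or> x div 4 = 3 \<or> x div 4 = 4 \<or> x div 4 = 5 \<or> x div 4 = 6"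
    using False assms(4) by auto
  then have "y \<in> {0, 8, 12, 16, 20, 24}" unfolding y_def by auto
  moreover have "y \<notin> {n. rot j n \<in> S}" using assms(3) x by simp
  ultimately obtain m where m: "m \<in> {4, 5, 6, 7}" "rot j m \<notin> S"
      "(link (chain_graph 1) {n. rot j n \<in> S})\<^sup>*\<^sup>* y m"
    using base_fans[OF link_rot(1,2)[OF assms(1,2) \<open>j < 4\<close>]] by blast
  have "rot j m div 4 = 1" using m(1) unfolding rot_def by auto
  then have "rot j m \<in> {4, 5, 6, 7}" by auto
  then show ?thesis using link_rot(3)[OF assms(1,2) \<open>j < 4\<close> m(3)] m(2) x by blast
qed

lemma middle_connected:
  assumes "finite S" "card S < 4" "m \<in> {4, 5, 6, 7}" "n \<in> {4, 5, 6, 7}" "m \<notin> S" "n \<notin> S"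
  shows "(link (chain_graph 1) S)\<^sup>*\<^sup>* m n"
proof -
  have *: "(link (chain_graph 1) S)\<^sup>*\<^sup>* (rot j 4) (rot j y)"
    if "j < 4" "y \<in> {5, 6}" "rot j 4 \<notin> S" "rot j y \<notin> S" for j y
    by (rule link_rot(3)[OF assms(1,2) that(1)], rule base_paths[OF link_rot(1,2)[OF assms(1,2) that(1)]])
       (use that in auto)
  have rots: "rot 0 4 = 4" "rot 0 5 = 5" "rot 0 6 = 6" "rot 1 4 = 5" "rot 1 5 = 6" "rot 1 6 = 7"
     "rot 2 4 = 6" "rot 2 5 = 7" "rot 3 4 = 7" "rot 3 5 = 4"
    by (simp_all add: rot_def)
  note links = *[of 0 5] *[of 0 6] *[of 1 5] *[of 1 6] *[of 2 5] *[of 3 5]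
  have up: "(link (chain_graph 1) S)\<^sup>*\<^sup>* m n \<or> (link (chain_graph 1) S)\<^sup>*\<^sup>* n m"
    using assms(3-6) links unfolding rots by auto
  then show ?thesis using link_sym by blast
qed

lemma block_connected:
  assumes "finite S" "card S < 4" "a \<notin> S" "b \<notin> S" "a < 28" "b < 28"
  shows "(link (chain_graph 1) S)\<^sup>*\<^sup>* a b"
proof -
  obtain m where m: "m \<in> {4, 5, 6, 7}" "m \<notin> S" "(link (chain_graph 1) S)\<^sup>*\<^sup>* a m"
    using block_to_middle[OF assms(1,2,3,5)] by blast
  obtain n where n: "n \<in> {4, 5, 6, 7}" "n \<notin> S" "(link (chain_graph 1) S)\<^sup>*\<^sup>* b n"
    using block_to_middle[OF assms(1,2,4,6)] by blast
  have "(link (chain_graph 1) S)\<^sup>*\<^sup>* m n" using middle_connected assms m n by blast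
  then show ?thesis using m(3) link_sym[OF n(3)] by (meson rtranclp_trans)
qed

lemma shifted_block_connected:
  assumes "finite S" "card S < 4" "t < k" "a \<notin> S" "b \<notin> S"
    "24 * t \<le> a" "a < 24 * t + 28" "24 * t \<le> b" "b < 24 * t + 28"
  shows "(link (chain_graph k) S)\<^sup>*\<^sup>* a b"
proof -
  define f where "f n = 24 * t + n" for n
  have "inj f" by (auto simp: f_def inj_def)
  have "finite {n. f n \<in> S}"
    using finite_vimageI[OF assms(1) \<open>inj f\<close>] by (simp add: vimage_def)
  moreover have "card {n. f n \<in> S} \<le> card S"
    by (rule card_inj_on_le[of f]) (use \<open>inj f\<close> assms(1) in \<open>auto simp: inj_on_def inj_def\<close>)
  moreover have f: "f (a - 24 * t) = a" "f (b - 24 * t) = b" using assms by (auto simp: f_def)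
  ultimately have "(link (chain_graph 1) {n. f n \<in> S})\<^sup>*\<^sup>* (a - 24 * t) (b - 24 * t)"
    using assms by (intro block_connected) auto
  then have "(link (chain_graph k) S)\<^sup>*\<^sup>* (f (a - 24 * t)) (f (b - 24 * t))"
    by (rule link_map) (use edges_shift[OF _ assms(3)] in \<open>simp add: f_def\<close>)
  then show ?thesis using f by simp
qed

text \<open>Consecutive blocks share four vertices, one of which survives the deletion of \<open>S\<close>.\<close>

lemma chain_linked:
  assumes "finite S" "card S < 4" "a \<notin> S" "b \<notin> S" "t < k" "a < 24 * t + 28" "b < 24 * t + 28"
  shows "(link (chain_graph k) S)\<^sup>*\<^sup>* a b"
  using assms(3-)
proof (induction t arbitrary: a b)
  case 0
  then show ?case using shifted_block_connected[OF assms(1,2), of 0] by simp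
next
  case (Suc t)
  have "\<not> {24 * Suc t..<24 * Suc t + 4} \<subseteq> S"
    using card_mono[OF assms(1), of "{24 * Suc t..<24 * Suc t + 4}"] assms(2) by auto
  then obtain m where "m \<in> {24 * Suc t..<24 * Suc t + 4}" "m \<notin> S" by blast
  then have m: "24 * Suc t \<le> m" "m < 24 * Suc t + 4" "m \<notin> S" by auto
  have *: "(link (chain_graph k) S)\<^sup>*\<^sup>* c m" if "c \<notin> S" "c < 24 * Suc t + 28" for c
  proof (cases "c < 24 * t + 28")
    case True
    then show ?thesis using Suc.IH[of c m] Suc.prems m that by simp
  next
    case False
    then show ?thesis
      using shifted_block_connected[OF assms(1,2), of "Suc t" k c m] Suc.prems m that by simp
  qed
  show ?case using *[of a] link_sym[OF *[of b]] Suc.prems by (meson rtranclp_trans)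
qed

lemma four_connected_chain_graph:
  assumes "k \<ge> 1"
  shows "k_connected_graph 4 (chain_graph k)"
  unfolding k_connected_graph_def
proof (intro conjI allI impI)
  show "simple_graph (chain_graph k)" by (rule simple_chain_graph)
  show "4 < card (verts (chain_graph k))" using assms by (simp add: chain_graph_def)
  fix S assume S: "S \<subseteq> verts (chain_graph k)" "card S < 4"
  then have fin: "finite S" by (auto simp: chain_graph_def intro: finite_subset)
  have rel: "(\<lambda>x y. {x, y} \<in> edges (delete_verts S (chain_graph k))) = link (chain_graph k) S"
    by (auto simp: fun_eq_iff link_def delete_verts_def)
  have "card S < card (verts (chain_graph k))" using S(2) assms by (simp add: chain_graph_def)
  then have "\<not> verts (chain_graph k) \<subseteq> S" using card_mono[OF fin] by (meson not_less)
  \<comment> \<open>Block \<open>k - 1\<close> ends with the last vertex, as 24 * (k - 1) + 28 = 24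
    * k + 4.\<close>
  then show "connected_graph (delete_verts S (chain_graph k))"
    unfolding connected_graph_def rel
    using chain_linked[OF fin S(2), of _ _ "k - 1" k] assms
    by (auto simp: delete_verts_def chain_graph_def)
qed

section \<open>Faces\<close>

text \<open>Twice the signed area of the triangle \<open>p\<close>, \<open>q\<close>,
  \<open>z\<close>; positive exactly if \<open>z\<close> is to the left of the line from
  \<open>p\<close> to \<open>q\<close>.\<close>

definition cross :: "complex \<Rightarrow> complex \<Rightarrow> complex \<Rightarrow> real" where
  "cross p q z = (Re q - Re p) * (Im z - Im p) - (Im q - Im p) * (Re z - Re p)"

definition polygon :: "(site \<times> site) set \<Rightarrow> complex set" where
  "polygon F = {z. \<forall>(p, q)\<in>F. 0 \<le> cross (site_point p) (site_point q) z}"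

text \<open>A bounded face is the intersection of the left half-planes of its directed sides. A side
  that ends in the crossing point is represented by the edge containing it.\<close>

definition faces :: "(site \<times> site) set set" where
  "faces =
    {{(I0,B), (B,C), (C,I1), (I1,I0)},
     {(B,D), (A,C), (C,B)},
     {(A,D), (D,B), (C,A)},
     {(M0,A), (A,C), (D,B), (B,M0)},
     {(M1,C), (C,A), (B,D), (D,M1)},
     {(A,O0), (O0,O1), (O1,D), (D,A)},
     {(I0,Cp), (Cp,M0), (M0,B), (B,I0)},
     {(M0,Dp), (Dp,O0), (O0,A), (A,M0)}}"

text \<open>Every side of a bounded face runs along one of these edges. The added pairs are a side
  of the next square and edges of the preceding trapezoid.\<close>

definition local_edges :: "(site \<times> site) set" where
  "local_edges = site_edges \<union> {(O0,O1), (I0,Cp), (Cp,M0), (M0,Dp), (Dp,O0)}"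

lemma closed_segment_cross:
  assumes "cross p q z = 0" "p \<noteq> q"
    "min (Re p) (Re q) \<le> Re z" "Re z \<le> max (Re p) (Re q)"
    "min (Im p) (Im q) \<le> Im z" "Im z \<le> max (Im p) (Im q)"
  shows "z \<in> closed_segment p q"
proof -
  have *: "z \<in> closed_segment p q" if "0 \<le> u" "u \<le> 1"
    "Re z - Re p = u * (Re q - Re p)" "Im z - Im p = u * (Im q - Im p)" for u
    unfolding in_segment
    by (rule exI[of _ u]) (use that in \<open>simp add: complex_eq_iff algebra_simps\<close>)
  have unit: "0 \<le> (x - a) / (b - a) \<and> (x - a) / (b - a) \<le> 1"
    if "a \<noteq> b" "min a b \<le> x" "x \<le> max a b" for a b x :: real
    using that by (cases "a < b") (auto simp: divide_simps)
  show ?thesis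
  proof (cases "Re p = Re q")
    case True
    then have "Im p \<noteq> Im q" using assms(2) by (auto simp: complex_eq_iff)
    moreover have "Re z = Re p" using True assms(3,4) by simp
    ultimately show ?thesis
      using *[of "(Im z - Im p) / (Im q - Im p)"] unit[of "Im p" "Im q" "Im z"] assms True by simp
  next
    case False
    moreover have "(Im z - Im p) = (Re z - Re p) / (Re q - Re p) * (Im q - Im p)"
      using assms(1) False unfolding cross_def by (simp add: field_simps)
    ultimately show ?thesis
      using *[of "(Re z - Re p) / (Re q - Re p)"] unit[of "Re p" "Re q" "Re z"] assms by simp
  qed
qed

text \<open>The other inequalities of the face confine \<open>z\<close> to the bounding box of the
  edge, and collinearity then puts it on the edge. For a side that ends in a crossing point this
  gives the whole edge, which is drawn as well.\<close>

lemma polygon_side: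
  assumes "F \<in> faces" "(p, q) \<in> F" "z \<in> polygon F" "cross (site_point p) (site_point q) z = 0"
  shows "z \<in> closed_segment (site_point p) (site_point q)"
proof -
  have "\<forall>F\<in>faces. (\<forall>(p, q)\<in>F. 0 \<le> cross (site_point p) (site_point q) z) \<longrightarrow>
    (\<forall>(p, q)\<in>F. cross (site_point p) (site_point q) z \<le> 0 \<longrightarrow>
      min (Re (site_point p)) (Re (site_point q)) \<le> Re z \<and> Re z \<le> max (Re (site_point p)) (Re (site_point q)) \<and>
      min (Im (site_point p)) (Im (site_point q)) \<le> Im z \<and> Im z \<le> max (Im (site_point p)) (Im (site_point q)))"
    unfolding faces_def ball_simps(5,7) case_prod_conv site_point.simps cross_def complex.sel
      simp_thms
    by (intro conjI impI; elim conjE; simp; linarith)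
  then have "min (Re (site_point p)) (Re (site_point q)) \<le> Re z \<and> Re z \<le> max (Re (site_point p)) (Re (site_point q)) \<and>
      min (Im (site_point p)) (Im (site_point q)) \<le> Im z \<and> Im z \<le> max (Im (site_point p)) (Im (site_point q))"
    using assms(1-3) eq_refl[OF assms(4)] unfolding polygon_def by blast
  moreover have "site_point p \<noteq> site_point q"
  proof -
    have "\<forall>F\<in>faces. \<forall>(p, q)\<in>F. site_point p \<noteq> site_point q"
      by (simp add: faces_def complex_eq_iff)
    with assms(1,2) show ?thesis by blast
  qed
  ultimately show ?thesis using closed_segment_cross assms(4) by blast
qed

lemma face_sides: "F \<in> faces \<Longrightarrow> (p, q) \<in> F \<Longrightarrow> (p, q) \<in> local_edges \<or> (q, p) \<in> local_edges"
proof -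
  have "\<forall>F\<in>faces. \<forall>(p, q)\<in>F. (p, q) \<in> local_edges \<or> (q, p) \<in> local_edges"
    by (simp add: faces_def local_edges_def site_edges_def)
  then show "F \<in> faces \<Longrightarrow> (p, q) \<in> F \<Longrightarrow> (p, q) \<in> local_edges \<or> (q, p) \<in> local_edges" by blast
qed

text \<open>The last bound is the line through \<open>Dp\<close> and \<open>O0\<close>. It keeps the
  maximum norm at most 6 and separates the faces from the open outer side of the preceding
  trapezoid.\<close>

lemma polygon_bounds:
  assumes "F \<in> faces" "z \<in> polygon F"
  shows "1 \<le> Re z" "Im z \<le> Re z" "Re z \<le> 6" "- 18 \<le> Re z + 4 * Im z"
proof -
  have "\<forall>F\<in>faces. (\<forall>(p, q)\<in>F. 0 \<le> cross (site_point p) (site_point q) z) \<longrightarrow>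
    1 \<le> Re z \<and> Im z \<le> Re z \<and> Re z \<le> 6 \<and> - 18 \<le> Re z + 4 * Im z"
    unfolding faces_def ball_simps(5,7) case_prod_conv site_point.simps cross_def complex.sel
      simp_thms
    by (intro conjI impI; elim conjE; simp; linarith)
  then show "1 \<le> Re z" "Im z \<le> Re z" "Re z \<le> 6" "- 18 \<le> Re z + 4 * Im z"
    using assms unfolding polygon_def by blast+
qed

text \<open>The faces with corner \<open>Cp\<close> or \<open>Dp\<close> straddle the ray between
  two trapezoids. Near its upper slanted side a point of \<open>cell\<close> thus belongs to a face
  of the following trapezoid, which \<open>- \<i>\<close> turns into position. The ten cases are the
  other six faces and the halves of these two.\<close>

lemma polygon_cover:
  assumes "w \<in> cell"
  shows "\<exists>F\<in>faces. w \<in> polygon F \<or> - \<i> * w \<in> polygon F"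
proof -
  define x y where "x = Re w" and "y = Im w"
  have xy: "1 \<le> x" "x < 6" "- x \<le> y" "y < x" using assms by (auto simp: cell_def x_def y_def)
  note [simp] = polygon_def cross_def faces_def x_def[symmetric] y_def[symmetric]
  have 1: ?thesis if "x \<le> 2 \<and> -1 \<le> y \<and> y \<le> 1"
    by (rule bexI[of _ "{(I0,B), (B,C), (C,I1), (I1,I0)}"]) (use xy that in \<open>simp_all\<close>)
  have 2: ?thesis if "2 * x + y \<le> 3 \<and> y \<le> -1"
    by (rule bexI[of _ "{(I0,Cp), (Cp,M0), (M0,B), (B,I0)}"]) (use xy that in \<open>simp_all\<close>)
  have 3: ?thesis if "2 * x - y \<le> 3 \<and> 1 \<le> y"
    by (rule bexI[of _ "{(I0,Cp), (Cp,M0), (M0,B), (B,I0)}"]) (use xy that in \<open>simp_all\<close>)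
  have 4: ?thesis if "2 \<le> x \<and> x + y \<le> 3 \<and> x - y \<le> 3"
    by (rule bexI[of _ "{(B,D), (A,C), (C,B)}"]) (use xy that in \<open>simp_all\<close>)
  have 5: ?thesis if "9 \<le> x - 2 * y \<and> 4 * x + y \<le> 18"
    by (rule bexI[of _ "{(M0,Dp), (Dp,O0), (O0,A), (A,M0)}"]) (use xy that in \<open>simp_all\<close>)
  have 6: ?thesis if "9 \<le> x + 2 * y \<and> 4 * x - y \<le> 18"
    by (rule bexI[of _ "{(M0,Dp), (Dp,O0), (O0,A), (A,M0)}"]) (use xy that in \<open>simp_all\<close>)
  have 7: ?thesis if "5 \<le> x \<and> 18 \<le> 4 * x + y \<and> 18 \<le> 4 * x - y"
    by (rule bexI[of _ "{(A,O0), (O0,O1), (O1,D), (D,A)}"]) (use xy that in \<open>simp_all\<close>)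
  have 8: ?thesis if "x \<le> 5 \<and> 3 \<le> x + y \<and> 3 \<le> x - y"
    by (rule bexI[of _ "{(A,D), (D,B), (C,A)}"]) (use xy that in \<open>simp_all\<close>)
  have 9: ?thesis if "x + y \<le> 3 \<and> 3 \<le> x - y \<and> x - 2 * y \<le> 9 \<and> 3 \<le> 2 * x + y"
    by (rule bexI[of _ "{(M0,A), (A,C), (D,B), (B,M0)}"]) (use xy that in \<open>simp_all\<close>)
  have 10: ?thesis if "x - y \<le> 3 \<and> 3 \<le> x + y \<and> x + 2 * y \<le> 9 \<and> 3 \<le> 2 * x - y"
    by (rule bexI[of _ "{(M1,C), (C,A), (B,D), (D,M1)}"]) (use xy that in \<open>simp_all\<close>)
  show ?thesis
  proof (rule ccontr)
    assume "\<not> ?thesis"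
    with 1 2 3 4 5 6 7 8 9 10 have no:
      "\<not> (x \<le> 2 \<and> -1 \<le> y \<and> y \<le> 1)"
      "\<not> (2 * x + y \<le> 3 \<and> y \<le> -1)"
      "\<not> (2 * x - y \<le> 3 \<and> 1 \<le> y)"
      "\<not> (2 \<le> x \<and> x + y \<le> 3 \<and> x - y \<le> 3)"
      "\<not> (9 \<le> x - 2 * y \<and> 4 * x + y \<le> 18)"
      "\<not> (9 \<le> x + 2 * y \<and> 4 * x - y \<le> 18)"
      "\<not> (5 \<le> x \<and> 18 \<le> 4 * x + y \<and> 18 \<le> 4 * x - y)"
      "\<not> (x \<le> 5 \<and> 3 \<le> x + y \<and> 3 \<le> x - y)"
      "\<not> (x + y \<le> 3 \<and> 3 \<le> x - y \<and> x - 2 * y \<le> 9 \<and> 3 \<le> 2 * x + y)"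
      "\<not> (x - y \<le> 3 \<and> 3 \<le> x + y \<and> x + 2 * y \<le> 9 \<and> 3 \<le> 2 * x - y)"
      by blast+
    show False using no xy by (smt (verit))
  qed
qed

section \<open>Closed faces of the whole drawing\<close>

definition drawn :: "nat \<Rightarrow> complex set" where
  "drawn k = (\<Union>e\<in>edges (chain_graph k). path_image (curve chain_drawing e))"

lemma path_image_chain_edge:
  assumes "{m, n} \<in> edges (chain_graph k)"
  shows "path_image (curve chain_drawing {m, n}) = closed_segment (vertex_point m) (vertex_point n)"
proof -
  obtain t j p q where x: "(t, j, p, q) \<in> edge_index k" "{m, n} = edge_at (t, j, p, q)"
    using assms by (auto simp: chain_graph_def)
  have "{vertex_point m, vertex_point n} = {cell_map t j (site_point p), cell_map t j (site_point q)}"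
    using edge_at_closed(1)[OF x(1)] x(2)[symmetric] by simp
  then show ?thesis
    unfolding x(2) curve_edge_at(3)[OF x(1)] by (auto simp: doubleton_eq_iff closed_segment_commute)
qed

lemma local_edge_in_graph:
  assumes "(p, q) \<in> local_edges" "t < k" "j < 4"
  shows "{label t j p, label t j q} \<in> edges (chain_graph k)"
proof -
  have edge: "edge_at x \<in> edges (chain_graph k)" if "x \<in> edge_index k" for x
    using that by (simp add: chain_graph_def)
  have j: "(j + 3) mod 4 < 4" "((j + 3) mod 4 + 1) mod 4 = j"
    using assms(3) unfolding less4_cases by auto
  consider "(p, q) \<in> site_edges" | "(p, q) = (O0, O1)" | "(p, q) = (I0, Cp)" | "(p, q) = (Cp, M0)"
    | "(p, q) = (M0, Dp)" | "(p, q) = (Dp, O0)"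
    using assms(1) unfolding local_edges_def by blast
  then show ?thesis
  proof cases
    case 1
    then show ?thesis using edge[of "(t, j, p, q)"] assms by (auto simp: edge_index_def edge_at_def)
  next
    case 2
    then show ?thesis using edge[of "(t + 1, j, I0, I1)"] assms
      by (cases "t + 1 = k") (auto simp: edge_index_def edge_at_def site_edges_def add.commute)
  next
    case 3
    then show ?thesis using edge[of "(t, (j + 3) mod 4, C, I1)"] assms j
      by (auto simp: edge_index_def edge_at_def site_edges_def insert_commute)
  next
    case 4
    then show ?thesis using edge[of "(t, (j + 3) mod 4, C, M1)"] assms j
      by (auto simp: edge_index_def edge_at_def site_edges_def insert_commute)
  next
    case 5
    then show ?thesis using edge[of "(t, (j + 3) mod 4, D, M1)"] assms j
      by (auto simp: edge_index_def edge_at_def site_edges_def insert_commute)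
  next
    case 6
    then show ?thesis using edge[of "(t, (j + 3) mod 4, D, O1)"] assms j
      by (auto simp: edge_index_def edge_at_def site_edges_def insert_commute)
  qed
qed

lemma local_edge_drawn:
  assumes "(p, q) \<in> local_edges" "t < k" "j < 4" "w \<in> closed_segment (site_point p) (site_point q)"
  shows "cell_map t j w \<in> drawn k"
proof -
  note e = local_edge_in_graph[OF assms(1-3)]
  have "cell_map t j w \<in> closed_segment (vertex_point (label t j p)) (vertex_point (label t j q))"
    using assms(3,4) by (auto simp: vertex_point_label simp flip: cell_map_segment)
  then show ?thesis unfolding drawn_def using path_image_chain_edge[OF e] e by blast
qed

lemma ring_edge: "i < 4 \<Longrightarrow> t \<le> k \<Longrightarrow> {24 * t + i, 24 * t + (i + 1) mod 4} \<in> edges (chain_graph k)"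
  by (auto simp: chain_graph_def edge_index_def site_edges_def edge_at_def
      intro!: image_eqI[of _ _ "(t, i, I0, I1)"])

lemma ring_point:
  assumes "sup_norm z = 6 ^ t"
  obtains j w where "j < 4" "w \<in> cell" "Re w = 1" "z = cell_map t j w"
proof -
  have "1 \<le> sup_norm z" using assms by simp
  then obtain t' j w where *: "j < 4" "w \<in> cell" "z = cell_map t' j w" by (rule cell_map_cover)
  then have "6 ^ t' * Re w = 6 ^ t * 1"
    using assms sup_norm_cell_map sup_norm_cell by simp
  moreover from this have "t' = t"
    by (rule power_six_unique) (use *(2) in \<open>auto simp: cell_def\<close>)
  ultimately show ?thesis using that * by simp
qed

lemma ring_drawn:
  assumes "sup_norm z = 6 ^ t" "t \<le> k"
  shows "z \<in> drawn k"
proof -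
  obtain j w where w: "j < 4" "w \<in> cell" "Re w = 1" "z = cell_map t j w"
    using assms(1) by (rule ring_point)
  have "w \<in> closed_segment (site_point I0) (site_point I1)"
    by (rule closed_segment_cross) (use w in \<open>auto simp: cell_def cross_def complex_eq_iff\<close>)
  then have "z \<in> closed_segment (vertex_point (label t j I0)) (vertex_point (label t j I1))"
    using w by (auto simp: vertex_point_label simp del: label.simps site_point.simps simp flip: cell_map_segment)
  then show ?thesis
    unfolding drawn_def using path_image_chain_edge ring_edge[OF w(1) assms(2)] by fastforce
qed

definition chain_face :: "nat \<Rightarrow> complex set \<Rightarrow> bool" where
  "chain_face k K \<longleftrightarrow> K = {z. sup_norm z \<le> 1} \<or> K = {z. 6 ^ k \<le> sup_norm z} \<or>
     (\<exists>t<k. \<exists>j<4. \<exists>F\<in>faces. K = {z. z / cell_map t j 1 \<in> polygon F})"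

lemma chain_face_cell:
  "t < k \<Longrightarrow> j < 4 \<Longrightarrow> F \<in> faces \<Longrightarrow> chain_face k {z. z / cell_map t j 1 \<in> polygon F}"
  unfolding chain_face_def by (intro disjI2 exI[of _ t] conjI exI[of _ j] bexI[of _ F] refl)

lemma cell_map_one: "cell_map t j 1 \<noteq> 0" "cell_map t j w / cell_map t j 1 = w"
    "cell_map t j (z / cell_map t j 1) = z"
  by (simp_all add: cell_map_def)

lemma continuous_on_sup_norm: "continuous_on S sup_norm"
  unfolding sup_norm_def[abs_def] by (intro continuous_intros)

lemma finite_faces: "F \<in> faces \<Longrightarrow> finite F"
  unfolding faces_def by (elim insertE emptyE) simp_all

text \<open>The strict inequalities define an open subset of the face, so a frontier point satisfies
  one of them with equality and therefore lies on a drawn side.\<close>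

lemma chain_face_boundary:
  assumes "chain_face k K"
  shows "closed K" "frontier K \<subseteq> drawn k"
proof -
  have *: "closed K \<and> frontier K \<subseteq> drawn k"
    if "closed K" "open U" "U \<subseteq> K" "K - U \<subseteq> drawn k" for K U
    using that interior_maximal[of U K] by (auto simp: frontier_def)
  consider "K = {z. sup_norm z \<le> 1}" | "K = {z. 6 ^ k \<le> sup_norm z}" |
    t j F where "t < k" "j < 4" "F \<in> faces" "K = {z. z / cell_map t j 1 \<in> polygon F}"
    using assms unfolding chain_face_def by blast
  then have "closed K \<and> frontier K \<subseteq> drawn k"
  proof cases
    case 1
    show ?thesis
    proof (rule *[of K "{z. sup_norm z < 1}"])
      show "K - {z. sup_norm z < 1} \<subseteq> drawn k"
        using ring_drawn[of _ 0 k] 1 by (auto simp: less_le)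
    qed (auto simp: 1 intro!: closed_Collect_le open_Collect_less continuous_on_sup_norm continuous_on_const)
  next
    case 2
    show ?thesis
    proof (rule *[of K "{z. 6 ^ k < sup_norm z}"])
      show "K - {z. 6 ^ k < sup_norm z} \<subseteq> drawn k"
        using ring_drawn[of _ k k] 2 by (auto simp: less_le)
    qed (auto simp: 2 intro!: closed_Collect_le open_Collect_less continuous_on_sup_norm continuous_on_const)
  next
    case 3
    have K: "K = (\<Inter>(p, q)\<in>F. {z. 0 \<le> cross (site_point p) (site_point q) (z / cell_map t j 1)})"
      unfolding 3(4) polygon_def by auto
    let ?U = "\<Inter>(p, q)\<in>F. {z. 0 < cross (site_point p) (site_point q) (z / cell_map t j 1)}"
    have cont: "continuous_on UNIV (\<lambda>z. cross (site_point p) (site_point q) (z / cell_map t j 1))" for p q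
      unfolding cross_def by (intro continuous_intros) (simp_all add: cell_map_one)
    show ?thesis
    proof (rule *[of K ?U])
      show "closed K"
        unfolding K by (intro closed_INT ballI) (auto intro!: closed_Collect_le cont continuous_on_const)
      show "open ?U"
        using finite_faces[OF 3(3)]
        by (intro open_INT ballI) (auto intro!: open_Collect_less cont continuous_on_const)
      show "?U \<subseteq> K" unfolding K by force
      show "K - ?U \<subseteq> drawn k"
      proof
        fix z assume z: "z \<in> K - ?U"
        define w where "w = z / cell_map t j 1"
        have w: "w \<in> polygon F" using z 3(4) by (simp add: w_def)
        obtain p q where pq: "(p, q) \<in> F" "\<not> 0 < cross (site_point p) (site_point q) w"
          using z unfolding w_def by auto
        then have "cross (site_point p) (site_point q) w = 0"
          using w unfolding polygon_def by force
        then have "w \<in> closed_segment (site_point p) (site_point q)"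
          using polygon_side[OF 3(3) pq(1) w] by simp
        then have "cell_map t j w \<in> drawn k"
          using face_sides[OF 3(3) pq(1)] local_edge_drawn 3(1,2) closed_segment_commute by metis
        then show "z \<in> drawn k" by (simp add: w_def cell_map_one)
      qed
    qed
  qed
  then show "closed K" "frontier K \<subseteq> drawn k" by blast+
qed

lemma chain_face_cover: "\<exists>K. chain_face k K \<and> z \<in> K"
proof (cases "sup_norm z \<le> 1 \<or> 6 ^ k \<le> sup_norm z")
  case True
  then show ?thesis unfolding chain_face_def by blast
next
  case False
  then have "1 \<le> sup_norm z" by simp
  then obtain t j w where w: "j < 4" "w \<in> cell" "z = cell_map t j w" by (rule cell_map_cover)
  have "t < k"
  proof (rule ccontr)
    assume "\<not> t < k"
    then have "(6::real) ^ k \<le> 6 ^ t" by (intro power_increasing) auto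
    also have "\<dots> \<le> 6 ^ t * Re w" using w(2) by (simp add: cell_def)
    finally show False using False w by (simp add: sup_norm_cell_map sup_norm_cell)
  qed
  obtain F where F: "F \<in> faces" "w \<in> polygon F \<or> - \<i> * w \<in> polygon F"
    using polygon_cover[OF w(2)] by blast
  then show ?thesis
  proof (elim disjE)
    assume "w \<in> polygon F"
    then have "z \<in> {z. z / cell_map t j 1 \<in> polygon F}" by (simp add: w(3) cell_map_one)
    then show ?thesis using chain_face_cell[OF \<open>t < k\<close> w(1) F(1)] by blast
  next
    assume "- \<i> * w \<in> polygon F"
    moreover have "cell_map t ((j + 1) mod 4) (- \<i> * w) = z"
      using w(1) unfolding w(3) cell_map_def less4_cases
      by (elim disjE) (simp_all add: i_power complex_eq_iff)
    ultimately have "z / cell_map t ((j + 1) mod 4) 1 \<in> polygon F" using cell_map_one(2) by metis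
    then have "z \<in> {z. z / cell_map t ((j + 1) mod 4) 1 \<in> polygon F}" by simp
    moreover have "(j + 1) mod 4 < 4" by simp
    ultimately show ?thesis using chain_face_cell[OF \<open>t < k\<close> _ F(1)] by blast
  qed
qed

section \<open>Vertices on a common face\<close>

lemma i_power_rotate:
  assumes "\<i> ^ j * w = \<i> ^ j' * v" "j < 4" "j' < 4"
  obtains d where "d < 4" "w = \<i> ^ d * v" "j' = (j + d) mod 4"
proof
  \<comment> \<open>The difference \<open>j' - j\<close> modulo 4, arranged to avoid truncated
    subtraction.\<close>
  let ?d = "(j' + (4 - j)) mod 4"
  show "?d < 4" by simp
  show j': "j' = (j + ?d) mod 4"
    using assms(2,3) unfolding less4_cases by (elim disjE) simp_all
  have "\<i> ^ j * \<i> ^ ?d = \<i> ^ j'"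
    using assms(2,3) unfolding less4_cases by (elim disjE) (simp_all add: i_power)
  then have "\<i> ^ j * w = \<i> ^ j * (\<i> ^ ?d * v)" using assms(1) by (simp flip: mult.assoc)
  then show "w = \<i> ^ ?d * v" by simp
qed

lemma polygon_sup_norm:
  assumes "F \<in> faces" "w \<in> polygon F"
  shows "1 \<le> sup_norm w" "sup_norm w \<le> 6"
  using polygon_bounds[OF assms] by (auto simp: sup_norm_def)

text \<open>A face may reach norm 6, where \<open>cell\<close> ends; such points have their
  coordinates in the next layer, which is the second alternative. Nonzero \<open>d\<close> accounts
  for face points on or beyond the slanted sides of \<open>cell\<close>.\<close>

lemma polygon_rotation:
  assumes F: "F \<in> faces" "w \<in> polygon F" and eq: "cell_map t j w = cell_map t' j' v"
    and v: "v \<in> cell" and j: "j < 4" "j' < 4"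
  obtains d where "d < 4" "j' = (j + d) mod 4" "t' = t" "w = \<i> ^ d * v"
  | d where "d < 4" "j' = (j + d) mod 4" "t' = Suc t" "w = 6 * (\<i> ^ d * v)" "Re v = 1"
proof -
  have sup: "6 ^ t * sup_norm w = 6 ^ t' * Re v"
    using arg_cong[OF eq, of sup_norm] j v by (simp add: sup_norm_cell_map sup_norm_cell)
  have Re_v: "1 \<le> Re v" "Re v < 6" using v by (auto simp: cell_def)
  show thesis
  proof (cases "sup_norm w < 6")
    case True
    then have "t = t'" using power_six_unique[OF sup] polygon_sup_norm[OF F] Re_v by simp
    then have "\<i> ^ j * w = \<i> ^ j' * v" using eq by (simp add: cell_map_def mult.assoc)
    then obtain d where "d < 4" "w = \<i> ^ d * v" "j' = (j + d) mod 4" using j by (rule i_power_rotate)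
    then show thesis using that(1) \<open>t = t'\<close> by blast
  next
    case False
    then have "sup_norm w = 6" using polygon_sup_norm[OF F] by simp
    then have sup': "6 ^ Suc t * 1 = 6 ^ t' * Re v" using sup by simp
    have t': "Suc t = t'" using power_six_unique[OF sup'] Re_v by simp
    then have "Re v = 1" using sup' by simp
    have "\<i> ^ j * w = \<i> ^ j' * (6 * v)" using eq t' by (auto simp: cell_map_def)
    then obtain d where "d < 4" "w = \<i> ^ d * (6 * v)" "j' = (j + d) mod 4" using j by (rule i_power_rotate)
    then show thesis using that(2)[of d] t' \<open>Re v = 1\<close> by simp
  qed
qed

text \<open>This makes incidence a finite question, with only the twelve sites left to test. Of the
  turned vertices the bounds admit only those named \<open>I1\<close>, \<open>M1\<close>,
  \<open>Cp\<close>, \<open>Dp\<close> and \<open>O1\<close>.\<close>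

lemma vertex_in_face:
  assumes F: "F \<in> faces" "w \<in> polygon F" and n: "vertex_point n = cell_map t j w" and j: "j < 4"
  obtains s where "n = label t j s" "w = site_point s"
proof -
  obtain t' j' v where v: "j' < 4" "v \<in> vertex_sites" "n = label t' j' v" by (rule vertex_label)
  have eq: "cell_map t j w = cell_map t' j' (site_point v)"
    using n v by (simp add: vertex_point_label)
  note bounds = polygon_bounds[OF F]
  from F eq vertex_site_in_cell[OF v(2)] j v(1) show thesis
  proof (cases rule: polygon_rotation)
    case (1 d)
    have "d = 0 \<or> d = 1 \<and> v \<in> {I0, M0} \<or> d = 3 \<and> v \<in> {C, D}"
      using bounds(1,2) v(2) 1(1) unfolding 1(4) vertex_sites_def less4_cases
      by (elim disjE insertE emptyE; simp add: i_power)
    then consider "d = 0" | "d = 1" "v = I0" | "d = 1" "v = M0" | "d = 3" "v = C" | "d = 3" "v = D"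
      by blast
    then show thesis
    proof cases
      case a: 1
      then show thesis using that[of v] 1 v j by simp
    next
      case a: 2
      show thesis by (rule that[of I1]) (use 1 v j a in \<open>simp_all add: complex_eq_iff\<close>)
    next
      case a: 3
      show thesis by (rule that[of M1]) (use 1 v j a in \<open>simp_all add: complex_eq_iff\<close>)
    next
      case a: 4
      show thesis by (rule that[of Cp]) (use 1 v j a in \<open>simp_all add: complex_eq_iff i_power\<close>)
    next
      case a: 5
      show thesis by (rule that[of Dp]) (use 1 v j a in \<open>simp_all add: complex_eq_iff i_power\<close>)
    qed
  next
    case (2 d)
    have "v = I0" using 2(5) v(2) by (auto simp: vertex_sites_def)
    have "d = 0 \<or> d = 1"
      using bounds(1,2) 2(1) unfolding 2(4) \<open>v = I0\<close> less4_cases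
      by (elim disjE; simp add: i_power)
    then show thesis
    proof
      assume "d = 0"
      show thesis by (rule that[of O0]) (use 2 v j \<open>v = I0\<close> \<open>d = 0\<close> in \<open>simp_all add: complex_eq_iff\<close>)
    next
      assume "d = 1"
      show thesis by (rule that[of O1]) (use 2 v j \<open>v = I0\<close> \<open>d = 1\<close> in \<open>simp_all add: complex_eq_iff\<close>)
    qed
  qed
qed

text \<open>In the order of \<open>faces\<close>. Crossing points are not vertices, hence the sets
  with two or three elements.\<close>

definition corner_sets :: "site set set" where
  "corner_sets = {{I0, B, C, I1}, {B, C}, {A, D}, {M0, A, B}, {M1, C, D}, {A, O0, O1, D},
     {I0, Cp, M0, B}, {M0, Dp, O0, A}}"

lemma polygon_corners:
  assumes "F \<in> faces"
  shows "\<exists>S\<in>corner_sets. \<forall>s. site_point s \<in> polygon F \<longrightarrow> s \<in> S"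
proof -
  have all: "(\<forall>s. P s) \<longleftrightarrow> P I0 \<and> P I1 \<and> P M0 \<and> P M1 \<and> P B \<and> P C \<and> P A \<and> P D \<and> P O0 \<and> P O1 \<and> P Cp \<and> P Dp" for P
  proof (intro iffI allI)
    fix s assume "P I0 \<and> P I1 \<and> P M0 \<and> P M1 \<and> P B \<and> P C \<and> P A \<and> P D \<and> P O0 \<and> P O1 \<and> P Cp \<and> P Dp"
    then show "P s" by (cases s) simp_all
  qed simp
  have "\<forall>F\<in>faces. \<exists>S\<in>corner_sets. \<forall>s. site_point s \<in> polygon F \<longrightarrow> s \<in> S"
    unfolding faces_def ball_simps(5,7) all
    by (simp add: polygon_def cross_def corner_sets_def)
  with assms show ?thesis by blast
qed

definition even_sites :: "site set" where
  "even_sites = {I0, M0, C, D, O0}"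

lemma even_label: "j < 4 \<Longrightarrow> even (label t j s) \<longleftrightarrow> (even j \<longleftrightarrow> s \<in> even_sites)"
  unfolding less4_cases even_sites_def by (cases s; elim disjE; simp)

lemma corners_adjacent:
  assumes "S \<in> corner_sets" "s \<in> S" "s' \<in> S"
  shows "(s \<in> even_sites \<longleftrightarrow> s' \<in> even_sites) \<or> (s, s') \<in> local_edges \<or> (s', s) \<in> local_edges"
proof -
  have "\<forall>S\<in>corner_sets. \<forall>s\<in>S. \<forall>s'\<in>S.
      (s \<in> even_sites \<longleftrightarrow> s' \<in> even_sites) \<or> (s, s') \<in> local_edges \<or> (s', s) \<in> local_edges"
    by (simp add: corner_sets_def even_sites_def local_edges_def site_edges_def)
  with assms show ?thesis by blast
qed

lemma sup_norm_vertex: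
  assumes "j < 4" "s \<in> vertex_sites"
  shows "sup_norm (vertex_point (label t j s)) = 6 ^ t * Re (site_point s)"
  using assms by (simp add: vertex_point_label sup_norm_cell_map sup_norm_cell vertex_site_in_cell)

lemma ring_vertex:
  assumes "sup_norm (vertex_point n) = 6 ^ t"
  shows "\<exists>i<4. n = 24 * t + i"
proof -
  obtain t' j s where s: "j < 4" "s \<in> vertex_sites" "n = label t' j s" by (rule vertex_label)
  then have eq: "6 ^ t * 1 = 6 ^ t' * Re (site_point s)" using assms by (simp add: sup_norm_vertex)
  have "t = t'"
    by (rule power_six_unique[OF eq]) (use vertex_site_in_cell[OF s(2)] in \<open>auto simp: cell_def\<close>)
  with eq have "Re (site_point s) = 1" by simp
  then have "s = I0" using s(2) by (auto simp: vertex_sites_def)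
  then show ?thesis using s \<open>t = t'\<close> by auto
qed

lemma inner_vertex: "sup_norm (vertex_point n) \<le> 1 \<Longrightarrow> \<exists>i<4. n = 24 * 0 + i"
proof -
  assume le: "sup_norm (vertex_point n) \<le> 1"
  obtain t j s where s: "j < 4" "s \<in> vertex_sites" "n = label t j s" by (rule vertex_label)
  have "1 * 1 \<le> 6 ^ t * Re (site_point s)"
    by (rule mult_mono) (use vertex_site_in_cell[OF s(2)] in \<open>auto simp: cell_def\<close>)
  then have "sup_norm (vertex_point n) = 6 ^ 0" using le s by (simp add: sup_norm_vertex)
  then show ?thesis by (rule ring_vertex)
qed

lemma outer_vertex:
  assumes "6 ^ k \<le> sup_norm (vertex_point n)" "n < 24 * k + 4"
  shows "\<exists>i<4. n = 24 * k + i"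
proof -
  obtain t j s where s: "j < 4" "s \<in> vertex_sites" "n = label t j s" by (rule vertex_label)
  have "\<not> t < k"
  proof
    assume "t < k"
    then have "(6::real) ^ Suc t \<le> 6 ^ k" by (intro power_increasing) auto
    moreover have "6 ^ t * Re (site_point s) < 6 ^ t * 6"
      by (rule mult_strict_left_mono) (use vertex_site_in_cell[OF s(2)] in \<open>auto simp: cell_def\<close>)
    moreover have "6 ^ k \<le> 6 ^ t * Re (site_point s)" using assms(1) s by (simp only: sup_norm_vertex)
    ultimately show False by simp
  qed
  then have "k \<le> t" by simp
  then have "24 * k \<le> n" using s unfolding vertex_sites_def by auto
  then show ?thesis using assms(2) by (intro exI[of _ "n - 24 * k"]) auto
qed

lemma ring_adjacent:
  assumes "i < 4" "i' < 4" "t \<le> k" "even (24 * t + i) \<noteq> even (24 * t + i')"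
  shows "{24 * t + i, 24 * t + i'} \<in> edges (chain_graph k)"
proof -
  have "i' = (i + 1) mod 4 \<or> i = (i' + 1) mod 4"
    using assms unfolding less4_cases by auto
  then show ?thesis
    using ring_edge[OF assms(1,3)] ring_edge[OF assms(2,3)] by (auto simp: insert_commute)
qed

text \<open>This excludes a new edge without crossings.\<close>

lemma chain_face_adjacent:
  assumes K: "chain_face k K" and mn: "vertex_point m \<in> K" "vertex_point n \<in> K"
    "m < 24 * k + 4" "n < 24 * k + 4" "even m \<noteq> even n"
  shows "{m, n} \<in> edges (chain_graph k)"
proof -
  consider "K = {z. sup_norm z \<le> 1}" | "K = {z. 6 ^ k \<le> sup_norm z}" |
    t j F where "t < k" "j < 4" "F \<in> faces" "K = {z. z / cell_map t j 1 \<in> polygon F}"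
    using K unfolding chain_face_def by blast
  then show ?thesis
  proof cases
    case 1
    then obtain i i' where "i < 4" "m = 24 * 0 + i" "i' < 4" "n = 24 * 0 + i'"
      using inner_vertex[of m] inner_vertex[of n] mn by blast
    then show ?thesis using ring_adjacent[of i i' 0 k] mn(5) by simp
  next
    case 2
    then obtain i i' where "i < 4" "m = 24 * k + i" "i' < 4" "n = 24 * k + i'"
      using outer_vertex[of k m] outer_vertex[of k n] mn by blast
    then show ?thesis using ring_adjacent[of i i' k k] mn(5) by simp
  next
    case 3
    have "vertex_point m / cell_map t j 1 \<in> polygon F" "vertex_point n / cell_map t j 1 \<in> polygon F"
      using mn(1,2) 3(4) by auto
    note P = this
    obtain s where s: "m = label t j s" "vertex_point m / cell_map t j 1 = site_point s"
      using vertex_in_face[OF 3(3) P(1) cell_map_one(3)[symmetric] 3(2)] by metis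
    obtain s' where s': "n = label t j s'" "vertex_point n / cell_map t j 1 = site_point s'"
      using vertex_in_face[OF 3(3) P(2) cell_map_one(3)[symmetric] 3(2)] by metis
    obtain S where "S \<in> corner_sets" "s \<in> S" "s' \<in> S"
      using polygon_corners[OF 3(3)] P s s' by metis
    moreover have "(s \<in> even_sites) \<noteq> (s' \<in> even_sites)"
      using mn(5) s s' even_label[OF 3(2)] by metis
    ultimately have "(s, s') \<in> local_edges \<or> (s', s) \<in> local_edges"
      using corners_adjacent by blast
    then show ?thesis using local_edge_in_graph[OF _ 3(1,2)] s s' by (metis insert_commute)
  qed
qed

lemma polygon_at_inner_side:
  assumes "F \<in> faces" "w \<in> polygon F" "Re w = 1" "- 1 < Im w" "Im w < 1" "site_point s \<in> polygon F"
  shows "s \<in> {I0, I1, B, C}"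
proof -
  have "\<forall>F\<in>faces. w \<in> polygon F \<longrightarrow> F = {(I0,B), (B,C), (C,I1), (I1,I0)}"
    using assms(3-5) unfolding faces_def ball_simps(5,7) polygon_def cross_def by simp
  then have F: "F = {(I0,B), (B,C), (C,I1), (I1,I0)}" using assms(1,2) by blast
  show ?thesis using assms(6) unfolding F by (cases s) (simp_all add: polygon_def cross_def)
qed

lemma polygon_at_outer_side:
  assumes "F \<in> faces" "w \<in> polygon F" "Re w = 6" "- 6 < Im w" "Im w < 6" "site_point s \<in> polygon F"
  shows "s \<in> {A, O0, O1, D}"
proof -
  have "\<forall>F\<in>faces. w \<in> polygon F \<longrightarrow> F = {(A,O0), (O0,O1), (O1,D), (D,A)}"
    using assms(3-5) unfolding faces_def ball_simps(5,7) polygon_def cross_def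
    by (simp; intro conjI impI; linarith)
  then have F: "F = {(A,O0), (O0,O1), (O1,D), (D,A)}" using assms(1,2) by blast
  show ?thesis using assms(6) unfolding F by (cases s) (simp_all add: polygon_def cross_def)
qed

text \<open>Here \<open>z\<close> stands for the point where a new edge crosses a square and
  \<open>n\<close> for one of its ends. On a bounded face at that side, every corner is an end of
  the side or belongs to a crossing, so this case is contradictory.\<close>

lemma chain_face_at_ring:
  assumes K: "chain_face k K" and z: "z \<in> K" "z \<in> open_edge (t, j, I0, I1)" and tj: "t \<le> k" "j < 4"
    and n: "vertex_point n \<in> K" "n < 24 * k + 4" "n \<notin> edge_at (t, j, I0, I1)"
    and uncrossed: "\<And>t j. t < k \<Longrightarrow> j < 4 \<Longrightarrow> n \<notin> label t j ` {A, B, C, D}"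
  shows "\<exists>i<4. n = 24 * t + i"
proof -
  obtain v where v: "v \<in> open_segment (site_point I0) (site_point I1)" "z = cell_map t j v"
    using z(2) unfolding open_edge_def by auto
  have v_coord: "Re v = 1" "- 1 < Im v" "Im v < 1"
    using v(1) unfolding in_open_segment_complex by auto
  then have v_cell: "v \<in> cell" by (simp add: cell_def)
  have sup: "sup_norm z = 6 ^ t"
    using v(2) tj v_cell v_coord by (simp add: sup_norm_cell_map sup_norm_cell)
  consider "K = {z. sup_norm z \<le> 1}" | "K = {z. 6 ^ k \<le> sup_norm z}" |
    t' j' F where "t' < k" "j' < 4" "F \<in> faces" "K = {z. z / cell_map t' j' 1 \<in> polygon F}"
    using K unfolding chain_face_def by blast
  then show ?thesis
  proof cases
    case 1
    then have "(6::real) ^ t \<le> 6 ^ 0" using z(1) sup by simp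
    then have "t = 0" using power_le_imp_le_exp[of "6::real" t 0] by simp
    then show ?thesis using inner_vertex n(1) 1 by auto
  next
    case 2
    then have "(6::real) ^ k \<le> 6 ^ t" using z(1) sup by simp
    then have "t = k" using tj(1) by (simp add: power_le_imp_le_exp antisym)
    then show ?thesis using outer_vertex n(1,2) 2 by auto
  next
    case 3
    define w where "w = z / cell_map t' j' 1"
    have w: "w \<in> polygon F" using z(1) 3(4) by (simp add: w_def)
    have eq: "cell_map t' j' w = cell_map t j v" using v(2) by (simp add: w_def cell_map_one)
    have P: "vertex_point n / cell_map t' j' 1 \<in> polygon F" using n(1) 3(4) by auto
    obtain s where s: "n = label t' j' s" "vertex_point n / cell_map t' j' 1 = site_point s"
      using vertex_in_face[OF 3(3) P cell_map_one(3)[symmetric] 3(2)] by metis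
    have s_face: "site_point s \<in> polygon F" using P s(2) by simp
    note bounds = polygon_bounds[OF 3(3) w]
    from 3(3) w eq v_cell 3(2) tj(2) have False
    proof (cases rule: polygon_rotation)
      case (1 d)
      \<comment> \<open>A turned copy of the open side violates \<open>1 \<le> Re w\<close>.\<close>
      have "d = 0"
        using bounds(1) v_coord 1(1) unfolding 1(4) less4_cases by (elim disjE; simp add: i_power)
      then have "s \<in> {I0, I1, B, C}"
        using polygon_at_inner_side[OF 3(3) w _ _ _ s_face] v_coord 1 by simp
      moreover have "j' = j" using 1 \<open>d = 0\<close> 3(2) by simp
      ultimately show False
        using n(3) uncrossed[OF 3(1,2)] s(1) 1(3) by (auto simp: edge_at_def)
    next
      case (2 d)
      have "d = 0"
        using bounds(1,2,4) v_coord 2(1) unfolding 2(4) less4_cases by (elim disjE; simp add: i_power)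
      then have "s \<in> {A, O0, O1, D}"
        using polygon_at_outer_side[OF 3(3) w _ _ _ s_face] v_coord 2 by simp
      moreover have "j' = j" using 2 \<open>d = 0\<close> 3(2) by simp
      ultimately show False
        using n(3) uncrossed[OF 3(1,2)] s(1) 2(3) by (auto simp: edge_at_def)
    qed
    then show ?thesis ..
  qed
qed

section \<open>Maximality\<close>

text \<open>The chain graph is connected, so its bipartition is the one by parity.\<close>

lemma bipartite_add_edge_parity:
  assumes "k \<ge> 1" "bipartite_graph (add_edge e (chain_graph k))"
  obtains u v where "e = {u, v}" "u < 24 * k + 4" "v < 24 * k + 4" "even u \<noteq> even v"
proof -
  let ?G = "add_edge e (chain_graph k)"
  obtain X Y where "X \<union> Y = verts ?G" and disj: "X \<inter> Y = {}"
    and "\<forall>f\<in>edges ?G. \<exists>x\<in>X. \<exists>y\<in>Y. f = {x, y}"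
    using assms(2) unfolding bipartite_graph_def by blast
  moreover have "edges ?G = insert e (edges (chain_graph k))" "verts ?G = {..<24 * k + 4}"
    by (simp_all add: add_edge_def chain_graph_def)
  ultimately have XY: "X \<union> Y = {..<24 * k + 4}"
    and edges: "\<And>f. f = e \<or> f \<in> edges (chain_graph k) \<Longrightarrow> \<exists>x\<in>X. \<exists>y\<in>Y. f = {x, y}"
    by auto
  \<comment> \<open>Along an edge both membership in \<open>X\<close> and parity change, so whether
    they agree is constant on a connected graph.\<close>
  have step: "(a \<in> X \<longleftrightarrow> even a) \<longleftrightarrow> (b \<in> X \<longleftrightarrow> even b)" if "link (chain_graph k) {} a b" for a b
  proof -
    have ab: "{a, b} \<in> edges (chain_graph k)" using that by (simp add: link_def)
    then have "(a \<in> X) \<noteq> (b \<in> X)" using edges[of "{a, b}"] disj by (auto simp: doubleton_eq_iff)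
    moreover obtain x where "x \<in> edge_index k" "{a, b} = edge_at x" using ab by (auto simp: chain_graph_def)
    then have "even a \<noteq> even b" using edge_at_verts(3)[of x k] by (auto simp: doubleton_eq_iff)
    ultimately show ?thesis by blast
  qed
  have const: "(a \<in> X \<longleftrightarrow> even a) \<longleftrightarrow> (b \<in> X \<longleftrightarrow> even b)" if "(link (chain_graph k) {})\<^sup>*\<^sup>* a b" for a b
    using that by (induction rule: rtranclp_induct) (use step in blast)+
  obtain u v where uv: "u \<in> X" "v \<in> Y" "e = {u, v}" using edges[of e] by blast
  then have lt: "u < 24 * k + 4" "v < 24 * k + 4" using XY by auto
  then have "(link (chain_graph k) {})\<^sup>*\<^sup>* u v"
    using chain_linked[of "{}" u v "k - 1" k] assms(1) by simp
  then have "even u \<noteq> even v" using const uv disj by blast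
  then show ?thesis using that uv(3) lt by blast
qed

text \<open>The open piece is connected and avoids the frontier of a face containing its midpoint,
  so it stays in that face; closedness adds the two ends.\<close>

lemma arc_piece_in_face:
  assumes c: "arc c" and ab: "0 \<le> a" "a < b" "b \<le> 1" and free: "c ` {a<..<b} \<inter> drawn k = {}"
  obtains K where "chain_face k K" "c a \<in> K" "c b \<in> K"
proof -
  obtain K where K: "chain_face k K" "c ((a + b) / 2) \<in> K" using chain_face_cover by blast
  note cK = chain_face_boundary[OF K(1)]
  have cont: "continuous_on S c" if "S \<subseteq> {0..1}" for S
    using c that continuous_on_subset unfolding arc_def path_def by blast
  have "connected (c ` {a<..<b})"
    by (rule connected_continuous_image[OF cont]) (use ab in auto)
  moreover have "(a + b) / 2 \<in> {a<..<b}" using ab by auto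
  then have "c ` {a<..<b} \<inter> K \<noteq> {}" using K(2) by blast
  moreover have "c ` {a<..<b} \<inter> frontier K = {}" using free cK(2) by blast
  ultimately have "c ` {a<..<b} \<subseteq> K" using connected_Int_frontier by blast
  then have "c ` closure {a<..<b} \<subseteq> K"
    using ab cont by (intro image_closure_subset cK(1)) (simp_all add: closure_greaterThanLessThan)
  then have "c ` {a..b} \<subseteq> K" using ab by simp
  then have "c a \<in> K" "c b \<in> K" using ab by (auto simp: image_subset_iff)
  then show ?thesis using that[OF K(1)] by blast
qed

lemma chain_maximal:
  assumes k: "k \<ge> 1" and new: "e \<notin> edges (chain_graph k)"
    and bip: "bipartite_IC_plane_graph (add_edge e (chain_graph k)) (draw_edge e c chain_drawing)"
  shows False
proof -
  let ?G = "add_edge e (chain_graph k)" and ?D = "draw_edge e c chain_drawing"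
  have IC: "IC_plane_graph ?G ?D" and bg: "bipartite_graph ?G"
    using bip by (simp_all add: bipartite_IC_plane_graph_def)
  then have one: "one_plane_graph ?G ?D" by (simp add: IC_plane_graph_def)
  then have good: "good_drawing ?G ?D" by (simp add: one_plane_graph_def)
  then have drawing: "is_drawing ?G ?D" by (simp add: good_drawing_def)
  obtain u v where uv: "e = {u, v}" "u < 24 * k + 4" "v < 24 * k + 4" "even u \<noteq> even v"
    using bipartite_add_edge_parity[OF k bg] .
  have G: "edges ?G = insert e (edges (chain_graph k))" "verts ?G = {..<24 * k + 4}"
    by (simp_all add: add_edge_def chain_graph_def)
  have D: "pos ?D = vertex_point" "curve ?D e = c"
    "\<And>f. f \<in> edges (chain_graph k) \<Longrightarrow> curve ?D f = curve chain_drawing f"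
    using new by (auto simp: draw_edge_def chain_drawing_def)
  have "arc (curve ?D e)" "{pathstart (curve ?D e), pathfinish (curve ?D e)} = pos ?D ` e"
    using drawing unfolding is_drawing_def G(1) by blast+
  then have c: "arc c" "{c 0, c 1} = {vertex_point u, vertex_point v}"
    unfolding D(1,2) pathstart_def pathfinish_def by (simp_all add: uv(1))
  have old: "edges_cross_at ?G ?D f g z" if "edges_cross_at (chain_graph k) chain_drawing f g z" for f g z
    using that D(3) unfolding edges_cross_at_def G(1) by auto
  have e_sym: "edges_cross_at ?G ?D f e z" if "edges_cross_at ?G ?D e f z" for f z
    using that curves_cross_at_sym unfolding edges_cross_at_def by blast
  have not_adj: "{u, v} \<notin> edges (chain_graph k)" using new uv(1) by simp

  \<comment> \<open>An arc is injective, so its inner points are not ends of \<open>e\<close>;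
    meeting an old edge there must be a crossing.\<close>
  have cross_meets: "\<exists>f. edges_cross_at ?G ?D e f (c s)" if s: "0 < s" "s < 1" "c s \<in> drawn k" for s
  proof -
    obtain f where f: "f \<in> edges (chain_graph k)" "c s \<in> path_image (curve chain_drawing f)"
      using s(3) unfolding drawn_def by blast
    have "e \<noteq> f" using f(1) new by blast
    then have "\<forall>z\<in>path_image (curve ?D e) \<inter> path_image (curve ?D f).
        z \<in> pos ?D ` (e \<inter> f) \<or> edges_cross_at ?G ?D e f z"
      using drawing f(1) unfolding is_drawing_def G(1) by blast
    moreover have "c s \<in> path_image (curve ?D e) \<inter> path_image (curve ?D f)"
      using s f D(2) D(3)[OF f(1)] by (auto simp: path_image_def)
    ultimately have "c s \<in> pos ?D ` (e \<inter> f) \<or> edges_cross_at ?G ?D e f (c s)" by blast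
    moreover have "c s \<notin> {c 0, c 1}"
      using c(1) s unfolding arc_def by (auto dest!: inj_onD)
    then have "c s \<notin> pos ?D ` (e \<inter> f)" unfolding c(2) D(1) using uv(1) by blast
    ultimately show ?thesis by blast
  qed
  have crossing: "\<exists>t j. t \<le> k \<and> j < 4 \<and> z \<in> open_edge (t, j, I0, I1) \<and>
      (\<forall>n\<in>e. n \<notin> edge_at (t, j, I0, I1) \<and> (\<forall>t j. t < k \<longrightarrow> j < 4 \<longrightarrow> n \<notin> label t j ` {A, B, C, D}))"
    if ef: "edges_cross_at ?G ?D e f z" for f z
  proof -
    have disj: "e \<inter> f = {}" using good ef unfolding good_drawing_def by blast
    have f: "f \<in> edges (chain_graph k)" and cr: "curves_cross_at (curve chain_drawing f) c z"
      using e_sym[OF ef] D new unfolding edges_cross_at_def G(1) by auto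
    then obtain x where x: "x \<in> edge_index k" "f = edge_at x" by (auto simp: chain_graph_def)
    have z: "z \<in> open_edge x" using curves_cross_at_open_edge x cr by blast
    have z_cr: "z \<in> crossings ?G ?D" using ef unfolding crossings_def by blast
    have ends: "e \<subseteq> crossing_ends ?G ?D z" "f \<subseteq> crossing_ends ?G ?D z"
      using ef e_sym[OF ef] unfolding crossing_ends_def by blast+
    \<comment> \<open>The point \<open>z\<close> differs from every old crossing, so the IC
      condition separates the ends of \<open>e\<close> and \<open>f\<close> from the ends of those
      crossings.\<close>
    have far: "n \<notin> label t j ` {A, B, C, D}" if n: "n \<in> e \<union> f" and tj: "t < k" "j < 4" for n t j
    proof -
      have \<alpha>: "edges_cross_at (chain_graph k) chain_drawing (edge_at (t, j, A, C)) (edge_at (t, j, B, D)) (cell_map t j 3)"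
        "edges_cross_at (chain_graph k) chain_drawing (edge_at (t, j, B, D)) (edge_at (t, j, A, C)) (cell_map t j 3)"
        unfolding edges_cross_at_chain using tj by blast+
      have idx: "(t, j, A, C) \<in> edge_index k" "(t, j, B, D) \<in> edge_index k"
        using tj by (auto simp: edge_index_def site_edges_def)
      \<comment> \<open>An edge of an old crossing has already used the single crossing allowed to
        it.\<close>
      have not_both: "f \<noteq> edge_at (t, j, A, C)" "f \<noteq> edge_at (t, j, B, D)"
      proof -
        have "f \<noteq> g" if g: "edges_cross_at (chain_graph k) chain_drawing g h (cell_map t j 3)" for g h
        proof
          assume "f = g"
          then have "e = h"
            using one e_sym[OF ef] old[OF g] unfolding one_plane_graph_def by blast
          moreover have "h \<in> edges (chain_graph k)" using g by (simp add: edges_cross_at_def)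
          ultimately show False using new by simp
        qed
        with \<alpha> show "f \<noteq> edge_at (t, j, A, C)" "f \<noteq> edge_at (t, j, B, D)" by blast+
      qed
      have "cell_map t j 3 \<noteq> z"
      proof
        assume "cell_map t j 3 = z"
        moreover have "cell_map t j 3 \<in> open_edge (t, j, A, C)"
          by (rule curves_cross_at_open_edge[OF idx(1) crossing_pair_cross[OF tj]])
        ultimately have "x = (t, j, A, C) \<or> (\<exists>t' j'. (t, j, A, C) = (t', j', A, C) \<and> x = (t', j', B, D))"
          using open_edges_meet[OF x(1) idx(1) z] by fastforce
        then show False using not_both x(2) by auto
      qed
      moreover have "cell_map t j 3 \<in> crossings ?G ?D"
        using old[OF \<alpha>(1)] unfolding crossings_def by blast
      ultimately have "crossing_ends ?G ?D (cell_map t j 3) \<inter> crossing_ends ?G ?D z = {}"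
        using IC z_cr unfolding IC_plane_graph_def by blast
      moreover have "edge_at (t, j, A, C) \<union> edge_at (t, j, B, D) \<subseteq> crossing_ends ?G ?D (cell_map t j 3)"
        using old[OF \<alpha>(1)] old[OF \<alpha>(2)] unfolding crossing_ends_def by blast
      ultimately show ?thesis using n ends by (auto simp: edge_at_def)
    qed
    obtain t j p q where tjpq: "x = (t, j, p, q)" by (cases x)
    have tj: "t \<le> k" "j < 4" "(p, q) \<in> site_edges" "t < k \<or> p = I0 \<and> q = I1"
      using x(1) by (auto simp: tjpq edge_index_def)
    \<comment> \<open>All other members of \<open>site_edges\<close> have an end among
      \<open>A\<close>, \<open>B\<close>, \<open>C\<close> and \<open>D\<close>.\<close>
    have "p = I0 \<and> q = I1"
    proof (rule ccontr)
      assume no: "\<not> ?thesis"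
      with tj have "t < k" by blast
      moreover have "{p, q} \<inter> {A, B, C, D} \<noteq> {}" using tj(3) no unfolding site_edges_def by auto
      ultimately show False
        using far[of "label t j p" t j] far[of "label t j q" t j] tj(2) x(2) unfolding tjpq
        by (auto simp: edge_at_def)
    qed
    then show ?thesis using tj(1,2) z far disj x(2) unfolding tjpq by blast
  qed
  show False
  proof (cases "c ` {0<..<1} \<inter> drawn k = {}")
    case True
    obtain K where K: "chain_face k K" "c 0 \<in> K" "c 1 \<in> K"
      using arc_piece_in_face[OF c(1) _ _ _ True] by (metis order_refl zero_less_one)
    then have "vertex_point u \<in> K" "vertex_point v \<in> K" using c(2) by (auto simp: doubleton_eq_iff)
    then show False using chain_face_adjacent[OF K(1) _ _ uv(2-4)] not_adj by blast
  next
    case False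
    then obtain s where s: "0 < s" "s < 1" "c s \<in> drawn k" by auto
    obtain f where f: "edges_cross_at ?G ?D e f (c s)" using cross_meets[OF s] by blast
    obtain t j where tj: "t \<le> k" "j < 4" "c s \<in> open_edge (t, j, I0, I1)"
      and far: "\<And>n. n \<in> e \<Longrightarrow> n \<notin> edge_at (t, j, I0, I1)"
        "\<And>n t j. n \<in> e \<Longrightarrow> t < k \<Longrightarrow> j < 4 \<Longrightarrow> n \<notin> label t j ` {A, B, C, D}"
      using crossing[OF f] by blast
    \<comment> \<open>Since \<open>e\<close> is crossed at most once, it meets the old drawing in a
      single inner point; the two pieces of the arc then each lie in one face.\<close>
    have only: "s' = s" if s': "0 < s'" "s' < 1" "c s' \<in> drawn k" for s'
    proof -
      obtain f' where "edges_cross_at ?G ?D e f' (c s')" using cross_meets[OF s'] by blast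
      then have "c s' = c s" using one f unfolding one_plane_graph_def by blast
      then show ?thesis using c(1) s s' unfolding arc_def by (auto dest!: inj_onD)
    qed
    have "c s' \<notin> drawn k" if "0 < s'" "s' < 1" "s' \<noteq> s" for s'
      using only[of s'] that by blast
    then have free: "c ` {0<..<s} \<inter> drawn k = {}" "c ` {s<..<1} \<inter> drawn k = {}"
      using s(1,2) by auto
    obtain K where K: "chain_face k K" "c 0 \<in> K" "c s \<in> K"
      by (rule arc_piece_in_face[OF c(1) _ s(1) _ free(1)]) (use s in auto)
    obtain K' where K': "chain_face k K'" "c s \<in> K'" "c 1 \<in> K'"
      by (rule arc_piece_in_face[OF c(1) _ s(2) _ free(2)]) (use s in auto)
    have ring: "\<exists>i<4. n = 24 * t + i" if "n \<in> e" for n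
    proof -
      have "vertex_point n \<in> K \<or> vertex_point n \<in> K'"
        using that c(2) K(2) K'(3) unfolding uv(1) by (auto simp: doubleton_eq_iff)
      moreover have "n < 24 * k + 4" using that uv by auto
      ultimately show ?thesis
        using chain_face_at_ring[OF K(1,3) tj(3,1,2)] chain_face_at_ring[OF K'(1,2) tj(3,1,2)] far that
        by metis
    qed
    then obtain i i' where "i < 4" "u = 24 * t + i" "i' < 4" "v = 24 * t + i'" using uv(1) by blast
    then show False using ring_adjacent[of i i' t k] tj(1) uv(4) not_adj by simp
  qed
qed

theorem theorem6p1:
  fixes k :: nat
  assumes "k \<ge> 1"
  shows "\<exists>(G :: nat ugraph) (D :: nat drawing).
           MBICP_graph G D \<and> k_connected_graph 4 G \<and>
           card (verts G) = 24 * k + 4 \<and>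
           real (card (edges G)) = 13 * real (card (verts G)) / 6 - 14 / 3"
proof (intro exI conjI)
  show "MBICP_graph (chain_graph k) chain_drawing"
    unfolding MBICP_graph_def bipartite_IC_plane_graph_def[of "chain_graph k"]
    using bipartite_chain_graph chain_IC_plane chain_maximal[OF assms] by blast
  show "k_connected_graph 4 (chain_graph k)" by (rule four_connected_chain_graph[OF assms])
  show verts: "card (verts (chain_graph k)) = 24 * k + 4" by (simp add: chain_graph_def)
  show "real (card (edges (chain_graph k))) = 13 * real (card (verts (chain_graph k))) / 6 - 14 / 3"
    unfolding verts card_edges_chain_graph by (simp add: field_simps)
qed

end
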